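(* Let $j\in\{\tfrac12,1,\tfrac32,\dots\}$, let $\boldsymbol{\Delta}^\uparrow=(\Delta^\uparrow_0,\dots,\Delta^\uparrow_{2j})$ be the vector of eigenvalues of the spin-$j$ Wigner kernel sorted into increasing order, and let $W_{\min}\in[\Delta^\uparrow_0,\tfrac{1}{2j+1}]$. Let $\rho$ be a spin-$j$ state with eigenvalues sorted in decreasing order $\boldsymbol{\lambda}^\downarrow=(\lambda^\downarrow_0,\dots,\lambda^\downarrow_{2j})$. Then every state in the unitary orbit of $\rho$ has Wigner function bounded below by $W_{\min}$, i.e. $$W_{U\rho U^\dagger}(\Omega)\ge W_{\min}\quad\text{for all }\Omega\in S^2\text{ and all }U\in \mathrm{SU}(2j+1),$$ if and only if $$\sum_{i=0}^{2j}\lambda^\downarrow_i\,\Delta^\uparrow_i\ \ge\ W_{\min}.$$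
   Context: A spin-$j$ state is a positive semidefinite operator $\rho$ of trace $1$ on $\mathcal H\simeq\mathbb C^{2j+1}$, where $\mathcal H$ carries the irreducible unitary spin-$j$ representation $g\mapsto U_g$ of $\mathrm{SU}(2)$, with Dicke basis $|j,m\rangle$, $m=-j,\dots,j$ (eigenvectors of $J_z$). The spin-$j$ Wigner kernel is $\Delta:S^2\to\mathcal L(\mathcal H)$, $$\Delta(\Omega)=\sqrt{\tfrac{4\pi}{2j+1}}\sum_{L=0}^{2j}\sum_{M=-L}^{L}Y_{LM}^*(\Omega)\,T_{LM},$$ where $Y_{LM}$ are the spherical harmonics (Condon–Shortley convention) and $T_{LM}=\sqrt{\tfrac{2L+1}{2j+1}}\sum_{m,m'}C^{j,m'}_{j,m;L,M}|j,m'\rangle\langle j,m|$ are the spherical tensor operators, with $C^{J,M}_{j_1,m_1;j_2,m_2}$ the Clebsch–Gordan coefficients. Equivalently, at the North pole ($\Omega=0$) the kernel is $\Delta(0)=\sum_{m=-j}^{j}\Delta_{j,m}|j,m\rangle\langle j,m|$ with $$\Delta_{j,m}=\sum_{L=0}^{2j}\frac{2L+1}{2j+1}\,C^{j,m}_{j,m;L,0},$$ and $\Delta(\Omega)=U_g\Delta(0)U_g^\dagger$ for any $g\in\mathrm{SU}(2)$ rotating the North pole to $\Omega$. Hence all $\Delta(\Omega)$ have the same eigenvalues $\{\Delta_{j,m}\}_{m=-j}^{j}$, called the kernel eigenvalues. The Wigner function of $\rho$ is $W_\rho(\Omega)=\mathrm{Tr}[\rho\,\Delta(\Omega)]$. 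*)

theory Defs
  imports "Jordan_Normal_Form.Schur_Decomposition" "HOL-Computational_Algebra.Polynomial" Complex_Main
begin

text \<open>
  Throughout, \<open>N\<close> is the natural number \<open>2 j\<close>, so that \<open>j = N / 2\<close> ranges over the
  half-integers. The Hilbert space is \<open>\<complex>\<^sup>N\<^sup>+\<^sup>1\<close> with the Dicke basis as standard basis:
  the index \<open>a \<in> {0..N}\<close> stands for \<open>|j, m\<rangle>\<close> with \<open>m = j - a\<close>.
\<close>

subsection \<open>Matrices, states and the special unitary group\<close>

definition mat_trace :: "complex mat \<Rightarrow> complex" where
  "mat_trace A = (\<Sum>i<dim_row A. A $$ (i, i))"

definition psd :: "nat \<Rightarrow> complex mat \<Rightarrow> bool" where
  "psd n A \<longleftrightarrow> A \<in> carrier_mat n n \<and> mat_adjoint A = A \<and>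
     (\<forall>v \<in> carrier_vec n. 0 \<le> Re ((A *\<^sub>v v) \<bullet>c v))"

definition spin_state :: "nat \<Rightarrow> complex mat \<Rightarrow> bool" where
  "spin_state N \<rho> \<longleftrightarrow> psd (N + 1) \<rho> \<and> mat_trace \<rho> = 1"

definition SU :: "nat \<Rightarrow> complex mat set" where
  "SU n = {U \<in> carrier_mat n n. mat_adjoint U * U = 1\<^sub>m n \<and> det U = 1}"

text \<open>
  Eigenvalues are listed with algebraic multiplicity. The lists are only used for Hermitian
  matrices, whose eigenvalues are real, so that taking real parts loses nothing.
\<close>

definition eigenvalues_up :: "complex mat \<Rightarrow> real list" where
  "eigenvalues_up A = sorted_list_of_multiset (image_mset Re (proots (char_poly A)))"

definition eigenvalues_down :: "complex mat \<Rightarrow> real list" where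
  "eigenvalues_down A = rev (eigenvalues_up A)"

subsection \<open>Clebsch-Gordan coefficients and spherical tensor operators\<close>

text \<open>
  Racah's explicit formula for \<open>\<langle>j1, m1; j2, m2 | J, M\<rangle>\<close> in the Condon-Shortley convention.
  The arguments are half-integers; \<open>rfact\<close> is only evaluated at non-negative integers, since
  \<open>k\<close> ranges over those values for which all factorials in the sum are defined.
\<close>

definition rfact :: "real \<Rightarrow> real" where
  "rfact x = fact (nat \<lfloor>x\<rfloor>)"

definition clebsch_gordan :: "real \<Rightarrow> real \<Rightarrow> real \<Rightarrow> real \<Rightarrow> real \<Rightarrow> real \<Rightarrow> real" where
  "clebsch_gordan j1 m1 j2 m2 J M =
    (if M = m1 + m2 \<and> \<bar>m1\<bar> \<le> j1 \<and> \<bar>m2\<bar> \<le> j2 \<and> \<bar>M\<bar> \<le> J \<and> \<bar>j1 - j2\<bar> \<le> J \<and> J \<le> j1 + j2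
     then
       sqrt ((2 * J + 1) * rfact (J + j1 - j2) * rfact (J - j1 + j2) * rfact (j1 + j2 - J)
              / rfact (j1 + j2 + J + 1)) *
       sqrt (rfact (J + M) * rfact (J - M) * rfact (j1 + m1) * rfact (j1 - m1)
              * rfact (j2 + m2) * rfact (j2 - m2)) *
       (\<Sum>k \<in> {k :: nat. real k \<le> j1 + j2 - J \<and> real k \<le> j1 - m1 \<and> real k \<le> j2 + m2 \<and>
                   0 \<le> J - j2 + m1 + real k \<and> 0 \<le> J - j1 - m2 + real k}.
          (-1) ^ k / (fact k * rfact (j1 + j2 - J - real k) * rfact (j1 - m1 - real k)
             * rfact (j2 + m2 - real k) * rfact (J - j2 + m1 + real k)
             * rfact (J - j1 - m2 + real k)))
     else 0)"

definition tensor_op :: "nat \<Rightarrow> nat \<Rightarrow> int \<Rightarrow> complex mat" where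
  "tensor_op N L M = mat (N + 1) (N + 1) (\<lambda>(a', a).
     let j = real N / 2; m' = j - real a'; m = j - real a in
     complex_of_real (sqrt ((2 * real L + 1) / (2 * j + 1)) *
       clebsch_gordan j m (real L) (of_int M) j m'))"

subsection \<open>Spherical harmonics\<close>

text \<open>
  Points of the sphere are given by (polar angle, azimuth); the non-uniqueness of the azimuth
  at the poles is harmless, because the spherical harmonics do not depend on it there.
\<close>

definition S2 :: "(real \<times> real) set" where
  "S2 = {0..pi} \<times> {0..<2 * pi}"

text \<open>
  The associated Legendre function \<open>P\<^sub>L\<^sup>m (cos \<theta>)\<close> for \<open>0 \<le> m\<close>, from Rodrigues' formula
  \<open>P\<^sub>L(x) = 1 / (2\<^sup>L L!) (d/dx)\<^sup>L (x\<^sup>2 - 1)\<^sup>L\<close> and with the Condon-Shortley phase \<open>(-1)\<^sup>m\<close>.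
  Here \<open>sin \<theta> = (1 - cos\<^sup>2 \<theta>)\<^sup>1\<^sup>/\<^sup>2\<close> since \<open>0 \<le> \<theta> \<le> \<pi>\<close>.
\<close>

definition assoc_legendre_cos :: "nat \<Rightarrow> nat \<Rightarrow> real \<Rightarrow> real" where
  "assoc_legendre_cos L m \<theta> =
     (-1) ^ m * sin \<theta> ^ m / (2 ^ L * fact L) *
       poly ((pderiv ^^ (L + m)) ([:-1, 0, 1:] ^ L)) (cos \<theta>)"

definition sph_harm_nonneg :: "nat \<Rightarrow> nat \<Rightarrow> real \<times> real \<Rightarrow> complex" where
  "sph_harm_nonneg L m = (\<lambda>(\<theta>, \<phi>).
     complex_of_real (sqrt ((2 * real L + 1) / (4 * pi) * fact (L - m) / fact (L + m))
       * assoc_legendre_cos L m \<theta>) * cis (real m * \<phi>))"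

definition sph_harm :: "nat \<Rightarrow> int \<Rightarrow> real \<times> real \<Rightarrow> complex" where
  "sph_harm L M \<Omega> =
     (if 0 \<le> M then sph_harm_nonneg L (nat M) \<Omega>
      else (-1) ^ nat (- M) * cnj (sph_harm_nonneg L (nat (- M)) \<Omega>))"

subsection \<open>The Wigner kernel and the Wigner function\<close>

definition wigner_kernel :: "nat \<Rightarrow> real \<times> real \<Rightarrow> complex mat" where
  "wigner_kernel N \<Omega> = mat (N + 1) (N + 1) (\<lambda>(a', a).
     complex_of_real (sqrt (4 * pi / (real N + 1))) *
       (\<Sum>L\<le>N. \<Sum>M = - int L..int L. cnj (sph_harm L M \<Omega>) * tensor_op N L M $$ (a', a)))"

text \<open>The trace below is real, as both factors are Hermitian.\<close>

definition wigner_function :: "nat \<Rightarrow> complex mat \<Rightarrow> real \<times> real \<Rightarrow> real" where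
  "wigner_function N \<rho> \<Omega> = Re (mat_trace (\<rho> * wigner_kernel N \<Omega>))"

end

theory Submission
  imports Defs
begin

text \<open>
  The kernel at \<open>\<Omega> = (\<theta>, \<phi>)\<close> is similar, by a diagonal matrix, to a real matrix \<open>R(\<theta>)\<close> that does
  not depend on \<open>\<phi>\<close>. The ladder relations of the Clebsch-Gordan coefficients (a telescoping sum in
  Racah's formula) and of the associated Legendre functions (Legendre's differential equation)
  combine to the Heisenberg equation \<open>R' = G R - R G\<close> with a constant matrix \<open>G\<close>. Hence the traces
  of all powers of \<open>R(\<theta>)\<close> are constant, and all kernels have the same eigenvalues.

  For Hermitian \<open>A = U diag(\<lambda>) U\<^sup>*\<close> and \<open>B = V diag(\<delta>) V\<^sup>*\<close> the trace of \<open>W A W\<^sup>* B\<close> is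
  \<open>\<Sum> \<lambda>\<^sub>i p\<^sub>i\<^sub>k \<delta>\<^sub>k\<close> with the doubly stochastic matrix of the \<open>\<bar>X\<^sub>k\<^sub>i\<bar>\<^sup>2\<close>, \<open>X = V\<^sup>* W U\<close>. Abel summation
  shows that it is minimal when \<open>p\<close> is the identity, with \<open>\<lambda>\<close> decreasing and \<open>\<delta>\<close> increasing;
  the minimum is attained at \<open>W = V U\<^sup>*\<close>, which a phase moves into the special unitary group.
\<close>

subsection \<open>Ladder relations for Racah's sum\<close>

text \<open>The value 0 at negative arguments is that of \<open>1 / Gamma (n + 1)\<close>. It lets
  Racah's sum run over a fixed range, with the conditions on \<open>k\<close> carried by the
  summand.\<close>

definition inv_fact :: "int \<Rightarrow> real" where
  "inv_fact n = (if n < 0 then 0 else 1 / fact (nat n))"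

lemma inv_fact_neg: "n < 0 \<Longrightarrow> inv_fact n = 0"
  by (simp add: inv_fact_def)

text \<open>With the zeros at negative integers the recursion holds on all integers; at
  \<open>n = 0\<close> the factor \<open>n\<close> produces the zero on the left.\<close>

lemma inv_fact_rec: "inv_fact (n - 1) = of_int n * inv_fact n"
proof (cases "n \<le> 0")
  case True
  then show ?thesis by (cases "n = 0") (auto simp: inv_fact_def)
next
  case False
  then obtain m where m: "n = int (Suc m)"
    by (metis not_le zero_less_imp_eq_int gr0_implies_Suc)
  have [simp]: "nat (1 + int m) = Suc m" by linarith
  have "1 + real m \<noteq> 0" by linarith
  then show ?thesis by (simp add: m inv_fact_def)
qed

definition parity :: "int \<Rightarrow> real" where
  "parity k = (if even k then 1 else - 1)"

text \<open>The summand of Racah's formula for \<open>j1 = J = N / 2\<close>, \<open>j2 = L\<close>,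
  \<open>m1 = N / 2 - a\<close> and \<open>M = N / 2 - a'\<close>. Counting from the top of the
  Dicke basis makes every argument an integer, and \<open>m2\<close> becomes
  \<open>a - a'\<close>.\<close>

definition cg_term :: "int \<Rightarrow> int \<Rightarrow> int \<Rightarrow> int \<Rightarrow> int \<Rightarrow> real" where
  "cg_term N L a' a k = parity k * inv_fact k * inv_fact (L - k) * inv_fact (a - k) *
     inv_fact (L + a - a' - k) * inv_fact (N - a - L + k) * inv_fact (k - a + a')"

definition cg_sum :: "int \<Rightarrow> nat \<Rightarrow> int \<Rightarrow> int \<Rightarrow> real" where
  "cg_sum N L a' a = (\<Sum>k\<le>L. cg_term N (int L) a' a (int k))"

text \<open>Each condition makes one of the six arguments negative, or a sum of two of them: for
  instance \<open>a' = (a - k) + (k - a + a')\<close> and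
  \<open>N - a' = (L + a - a' - k) + (N - a - L + k)\<close>.\<close>

lemma cg_term_eq_0:
  assumes "a' < 0 \<or> a < 0 \<or> N < a' \<or> N < a \<or> L < \<bar>a - a'\<bar> \<or> k < 0 \<or> L < k"
  shows "cg_term N L a' a k = 0"
proof -
  have "k < 0 \<or> L - k < 0 \<or> a - k < 0 \<or> L + a - a' - k < 0 \<or> N - a - L + k < 0 \<or> k - a + a' < 0"
    using assms by linarith
  then show ?thesis by (auto simp: cg_term_def inv_fact_neg)
qed

lemma cg_sum_eq_0:
  assumes "a' < 0 \<or> a < 0 \<or> N < a' \<or> N < a \<or> int L < \<bar>a - a'\<bar>"
  shows "cg_sum N L a' a = 0"
  unfolding cg_sum_def using assms by (intro sum.neutral ballI cg_term_eq_0) auto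

text \<open>Creative telescoping. The certificate \<open>H k\<close> is
  \<open>k * cg_term N L a' a k\<close>, written with \<open>inv_fact (k - 1)\<close>; after
  reduction to common factors a polynomial identity remains.\<close>

lemma cg_term_raise:
  fixes N L a' a k :: int
  defines "H \<equiv> \<lambda>k. parity k * inv_fact (k - 1) * inv_fact (L - k) * inv_fact (a - k) *
     inv_fact (L + a - a' - k) * inv_fact (N - a - L + k) * inv_fact (k - a + a')"
  shows "of_int (a' + 1) * cg_term N L (a' + 1) a k - of_int (N - a + 1) * cg_term N L a' (a - 1) k
     - of_int (L + a - a') * cg_term N L a' a k = H (k + 1) - H k"
proof -
  \<comment> \<open>Each factor is recorded at the largest argument it takes, so that
    \<open>inv_fact_rec\<close> only lowers arguments and nothing is divided.\<close>
  define i1 i2 i3 i4 i5 i6 where i: "i1 = inv_fact k" "i2 = inv_fact (L - k)" "i3 = inv_fact (a - k)"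
    "i4 = inv_fact (L + a - a' - k)" "i5 = inv_fact (N - a - L + k + 1)" "i6 = inv_fact (k - a + a' + 1)"
  have r: "inv_fact (k - 1) = of_int k * i1"
    "inv_fact (L - k - 1) = of_int (L - k) * i2"
    "inv_fact (a - k - 1) = of_int (a - k) * i3"
    "inv_fact (L + a - a' - k - 1) = of_int (L + a - a' - k) * i4"
    "inv_fact (N - a - L + k) = of_int (N - a - L + k + 1) * i5"
    "inv_fact (k - a + a') = of_int (k - a + a' + 1) * i6"
    using inv_fact_rec[of k] inv_fact_rec[of "L - k"] inv_fact_rec[of "a - k"]
      inv_fact_rec[of "L + a - a' - k"] inv_fact_rec[of "N - a - L + k + 1"]
      inv_fact_rec[of "k - a + a' + 1"]
    by (simp_all add: i)
  have s: "parity (k + 1) = - parity k" by (simp add: parity_def)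
  have e: "L + a - (a' + 1) - k = L + a - a' - k - 1" "k - a + (a' + 1) = k - a + a' + 1"
    "a - 1 - k = a - k - 1" "L + (a - 1) - a' - k = L + a - a' - k - 1"
    "N - (a - 1) - L + k = N - a - L + k + 1" "k - (a - 1) + a' = k - a + a' + 1"
    "L - (k + 1) = L - k - 1" "a - (k + 1) = a - k - 1" "L + a - a' - (k + 1) = L + a - a' - k - 1"
    "N - a - L + (k + 1) = N - a - L + k + 1" "k + 1 - a + a' = k - a + a' + 1" "k + 1 - 1 = k"
    by simp_all
  have X: "cg_term N L (a' + 1) a k =
      parity k * i1 * i2 * i3 * (of_int (L + a - a' - k) * i4) * (of_int (N - a - L + k + 1) * i5) * i6"
    by (simp only: cg_term_def e r i[symmetric] mult_minus_left)
  have Y: "cg_term N L a' (a - 1) k =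
      parity k * i1 * i2 * (of_int (a - k) * i3) * (of_int (L + a - a' - k) * i4) * i5 * i6"
    by (simp only: cg_term_def e r i[symmetric] mult_minus_left)
  have Z: "cg_term N L a' a k =
      parity k * i1 * i2 * i3 * i4 * (of_int (N - a - L + k + 1) * i5) * (of_int (k - a + a' + 1) * i6)"
    by (simp only: cg_term_def e r i[symmetric] mult_minus_left)
  have H0: "H k = parity k * (of_int k * i1) * i2 * i3 * i4 * (of_int (N - a - L + k + 1) * i5) *
      (of_int (k - a + a' + 1) * i6)"
    by (simp only: H_def e r i[symmetric] mult_minus_left)
  have H1: "H (k + 1) = - parity k * i1 * (of_int (L - k) * i2) * (of_int (a - k) * i3) *
      (of_int (L + a - a' - k) * i4) * i5 * i6"
    by (simp only: H_def s e r i[symmetric] mult_minus_left)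
  show ?thesis unfolding X Y Z H0 H1 by (simp add: algebra_simps)
qed

text \<open>The telescoped sum leaves two boundary values, and both contain
  \<open>inv_fact (- 1)\<close>. Up to normalizing square roots this is the commutator of
  \<open>J_+\<close> with the tensor operator of order \<open>a - a' - 1\<close>.\<close>

lemma cg_sum_raise:
  "of_int (a' + 1) * cg_sum N L (a' + 1) a - of_int (N - a + 1) * cg_sum N L a' (a - 1)
     = of_int (int L + a - a') * cg_sum N L a' a"
proof -
  define H where "H = (\<lambda>k. parity k * inv_fact (k - 1) * inv_fact (int L - k) * inv_fact (a - k) *
     inv_fact (int L + a - a' - k) * inv_fact (N - a - int L + k) * inv_fact (k - a + a'))"
  have "of_int (a' + 1) * cg_sum N L (a' + 1) a - of_int (N - a + 1) * cg_sum N L a' (a - 1)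
     - of_int (int L + a - a') * cg_sum N L a' a = (\<Sum>k\<le>L. H (int (Suc k)) - H (int k))"
    unfolding cg_sum_def sum_distrib_left sum_subtractf[symmetric] H_def
    by (rule sum.cong[OF refl], subst cg_term_raise) (simp add: add.commute)
  also have "\<dots> = H (int (Suc L)) - H 0"
    by (induction L) auto
  also have "\<dots> = 0" by (simp add: H_def inv_fact_neg)
  finally show ?thesis by linarith
qed

lemma cg_sum_int: "cg_sum N L a' a = (\<Sum>k\<in>{0..int L}. cg_term N (int L) a' a k)"
  unfolding cg_sum_def by (rule sum.reindex_bij_witness[of _ nat int]) auto

text \<open>The substitution of \<open>L - k\<close> for \<open>k\<close> permutes the six
  factorials. This is the symmetry under reversal of all magnetic quantum numbers.\<close>

lemma cg_sum_reflect: "cg_sum N L (N - a') (N - a) = parity (int L) * cg_sum N L a' a"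
  unfolding cg_sum_int sum_distrib_left
  by (rule sum.reindex_bij_witness[of _ "\<lambda>k. int L - k" "\<lambda>k. int L - k"])
    (auto simp: cg_term_def parity_def algebra_simps)

text \<open>Reversing the Dicke basis exchanges raising and lowering, so this is
  \<open>cg_sum_raise\<close> at reflected indices; the sign \<open>parity (int L)\<close> is common
  to all terms.\<close>

lemma cg_sum_lower:
  "of_int (N - a' + 1) * cg_sum N L (a' - 1) a - of_int (a + 1) * cg_sum N L a' (a + 1)
     = of_int (int L - a + a') * cg_sum N L a' a"
proof -
  have p: "parity (int L) \<noteq> 0" by (simp add: parity_def)
  have "parity (int L) * (of_int (N - a' + 1) * cg_sum N L (a' - 1) a - of_int (a + 1) * cg_sum N L a' (a + 1))
     = parity (int L) * (of_int (int L - a + a') * cg_sum N L a' a)"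
    using cg_sum_raise[of "N - a'" N L "N - a"] cg_sum_reflect[of N L a' a]
      cg_sum_reflect[of N L "a' - 1" a] cg_sum_reflect[of N L a' "a + 1"]
    by (simp add: algebra_simps)
  with p show ?thesis by simp
qed

text \<open>Shifting the summation index by \<open>a - a'\<close> permutes the six factorials, and
  the parity of the shift is the sign.\<close>

lemma cg_sum_swap: "cg_sum N L a a' = parity (a - a') * cg_sum N L a' a"
proof -
  \<comment> \<open>The range on which four of the factorial arguments are nonnegative. Outside it
    the terms vanish, and the shift maps the two restricted ranges onto each other.\<close>
  let ?M = "a - a'" and ?D = "{max 0 (a - a')..min (int L) (int L + (a - a'))}"
  have "cg_sum N L a' a = (\<Sum>k\<in>?D. cg_term N (int L) a' a k)"
    unfolding cg_sum_int
    by (rule sum.mono_neutral_right) (auto simp: cg_term_def inv_fact_neg)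
  moreover have "cg_sum N L a a' = (\<Sum>k\<in>{max 0 (a' - a)..min (int L) (int L + (a' - a))}. cg_term N (int L) a a' k)"
    unfolding cg_sum_int
    by (rule sum.mono_neutral_right) (auto simp: cg_term_def inv_fact_neg)
  moreover have "\<dots> = (\<Sum>k\<in>?D. parity ?M * cg_term N (int L) a' a k)"
    by (rule sum.reindex_bij_witness[of _ "\<lambda>k. k - ?M" "\<lambda>k. k + ?M"])
      (auto simp: cg_term_def parity_def algebra_simps)
  ultimately show ?thesis by (simp add: sum_distrib_left)
qed

subsection \<open>Associated Legendre functions\<close>

definition rodrigues :: "nat \<Rightarrow> nat \<Rightarrow> real poly" where
  "rodrigues L n = (pderiv ^^ n) ([:-1, 0, 1:] ^ L)"

lemma pderiv_rodrigues: "pderiv (rodrigues L n) = rodrigues L (Suc n)"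
  by (simp add: rodrigues_def)

text \<open>Repeated differentiation of \<open>(x^2 - 1) w' = 2 L x w\<close>, which holds for
  \<open>w = (x^2 - 1)^L\<close>. At \<open>n = L + m\<close> it is the equation of the
  \<open>m\<close>-th derivative of the Legendre polynomial.\<close>

lemma rodrigues_ode:
  "[:-1, 0, 1:] * rodrigues L (Suc (Suc n)) + smult (2 * (real n + 1 - real L)) ([:0, 1:] * rodrigues L (Suc n))
     + smult ((real n + 1) * (real n - 2 * real L)) (rodrigues L n) = 0"
proof (induction n)
  case 0
  have "[:-1, 0, 1:] * rodrigues L (Suc 0) = smult (2 * real L) ([:0, 1:] * rodrigues L 0)"
  proof (cases L)
    case 0
    then show ?thesis by (simp add: rodrigues_def)
  next
    case (Suc l)
    define w where "w = ([:-1, 0, 1:] :: real poly)"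
    have "pderiv w = [:0, 2:]" by (simp add: w_def pderiv_pCons)
    then have "w * pderiv (w ^ Suc l) = smult (2 * real (Suc l)) ([:0, 1:] * w ^ Suc l)"
      unfolding pderiv_power_Suc
      by (simp add: poly_eq_poly_eq_iff[symmetric] fun_eq_iff algebra_simps del: mult_pCons_left mult_pCons_right)
    then show ?thesis
      by (simp add: rodrigues_def Suc w_def)
  qed
  then have "pderiv ([:-1, 0, 1:] * rodrigues L (Suc 0)) = pderiv (smult (2 * real L) ([:0, 1:] * rodrigues L 0))"
    by simp
  then show ?case
    by (simp add: pderiv_mult pderiv_smult pderiv_rodrigues pderiv_pCons poly_eq_poly_eq_iff[symmetric] fun_eq_iff
      algebra_simps del: mult_pCons_left mult_pCons_right)
next
  case (Suc n)
  have "pderiv ([:-1, 0, 1:] * rodrigues L (Suc (Suc n)) + smult (2 * (real n + 1 - real L)) ([:0, 1:] * rodrigues L (Suc n))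
     + smult ((real n + 1) * (real n - 2 * real L)) (rodrigues L n)) = 0"
    by (simp only: Suc pderiv_0)
  then show ?case
    by (simp add: pderiv_mult pderiv_smult pderiv_rodrigues pderiv_add pderiv_pCons poly_eq_poly_eq_iff[symmetric] fun_eq_iff
      algebra_simps del: mult_pCons_left mult_pCons_right)
qed

lemma poly_rodrigues_ode:
  "(x\<^sup>2 - 1) * poly (rodrigues L (Suc (Suc n))) x + 2 * (real n + 1 - real L) * x * poly (rodrigues L (Suc n)) x
     + (real n + 1) * (real n - 2 * real L) * poly (rodrigues L n) x = 0"
  using arg_cong[OF rodrigues_ode[of L n], of "\<lambda>p. poly p x"]
  by (simp add: algebra_simps power2_eq_square)

lemma assoc_legendre_cos_rodrigues:
  "assoc_legendre_cos L m \<theta> = (-1) ^ m * sin \<theta> ^ m / (2 ^ L * fact L) * poly (rodrigues L (L + m)) (cos \<theta>)"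
  by (simp add: assoc_legendre_cos_def rodrigues_def)

lemma DERIV_poly_rodrigues_cos:
  "((\<lambda>\<theta>. poly (rodrigues L n) (cos \<theta>)) has_real_derivative - sin \<theta> * poly (rodrigues L (Suc n)) (cos \<theta>)) (at \<theta>)"
  by (auto intro!: derivative_eq_intros DERIV_chain2[OF poly_DERIV] simp: pderiv_rodrigues)

lemma DERIV_assoc_legendre_cos_0:
  "(assoc_legendre_cos L 0 has_real_derivative assoc_legendre_cos L 1 \<theta>) (at \<theta>)"
proof -
  have "assoc_legendre_cos L 0 = (\<lambda>\<theta>. 1 / (2 ^ L * fact L) * poly (rodrigues L L) (cos \<theta>))"
    by (simp add: assoc_legendre_cos_rodrigues fun_eq_iff)
  then show ?thesis
    using DERIV_cmult[OF DERIV_poly_rodrigues_cos, of "1 / (2 ^ L * fact L)" L L \<theta>]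
    by (simp add: assoc_legendre_cos_rodrigues)
qed

text \<open>Differentiating a power of the sine times a polynomial in the cosine leaves a term
  \<open>cos \<theta> * p1\<close>; Legendre's equation trades it for the neighbouring orders
  \<open>m\<close> and \<open>m + 2\<close>.\<close>

lemma DERIV_assoc_legendre_cos_Suc:
  "(assoc_legendre_cos L (Suc m) has_real_derivative
     (assoc_legendre_cos L (Suc (Suc m)) \<theta> - (real L + real m + 1) * (real L - real m) * assoc_legendre_cos L m \<theta>) / 2)
     (at \<theta>)"
proof -
  define c :: real where "c = (-1) ^ m / (2 ^ L * fact L)"
  define p0 p1 p2 where p: "p0 = poly (rodrigues L (L + m)) (cos \<theta>)"
    "p1 = poly (rodrigues L (Suc (L + m))) (cos \<theta>)" "p2 = poly (rodrigues L (Suc (Suc (L + m)))) (cos \<theta>)"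
  have a: "assoc_legendre_cos L (Suc m) = (\<lambda>\<theta>. - c * (sin \<theta> ^ Suc m * poly (rodrigues L (Suc (L + m))) (cos \<theta>)))"
    by (simp add: assoc_legendre_cos_rodrigues c_def fun_eq_iff)
  have A: "assoc_legendre_cos L m \<theta> = c * sin \<theta> ^ m * p0"
    "assoc_legendre_cos L (Suc (Suc m)) \<theta> = c * sin \<theta> ^ m * (sin \<theta>)\<^sup>2 * p2"
    by (simp_all add: assoc_legendre_cos_rodrigues c_def p power2_eq_square)
  have s: "((\<lambda>\<theta>. sin \<theta> ^ Suc m) has_real_derivative (real m + 1) * sin \<theta> ^ m * cos \<theta>) (at \<theta>)"
    by (rule DERIV_cong[OF DERIV_power[OF DERIV_sin]]) simp
  have "(assoc_legendre_cos L (Suc m) has_real_derivative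
     - c * ((real m + 1) * sin \<theta> ^ m * cos \<theta> * p1 - sin \<theta> ^ Suc m * sin \<theta> * p2)) (at \<theta>)"
    unfolding a
    by (rule DERIV_cong[OF DERIV_cmult[OF DERIV_mult[OF s DERIV_poly_rodrigues_cos]]]) (simp add: p algebra_simps)
  moreover have "((cos \<theta>)\<^sup>2 - 1) * p2 + 2 * (real (L + m) + 1 - real L) * cos \<theta> * p1
     + (real (L + m) + 1) * (real (L + m) - 2 * real L) * p0 = 0"
    unfolding p by (rule poly_rodrigues_ode)
  then have "2 * (real m + 1) * cos \<theta> * p1 = (sin \<theta>)\<^sup>2 * p2 + (real L + real m + 1) * (real L - real m) * p0"
    unfolding cos_squared_eq by (simp add: algebra_simps)
  then have "c * sin \<theta> ^ m * (2 * (real m + 1) * cos \<theta> * p1) =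
     c * sin \<theta> ^ m * ((sin \<theta>)\<^sup>2 * p2 + (real L + real m + 1) * (real L - real m) * p0)" by simp
  then have "- c * ((real m + 1) * sin \<theta> ^ m * cos \<theta> * p1 - sin \<theta> ^ Suc m * sin \<theta> * p2) =
     (assoc_legendre_cos L (Suc (Suc m)) \<theta> - (real L + real m + 1) * (real L - real m) * assoc_legendre_cos L m \<theta>) / 2"
    unfolding A by (simp add: algebra_simps power2_eq_square)
  ultimately show ?thesis by (rule DERIV_cong)
qed

text \<open>
  For \<open>\<bar>M\<bar> \<le> L\<close> this is \<open>(L - M)! P\<^sub>L\<^sup>M (cos \<theta>)\<close>, also for negative \<open>M\<close>. The factor
  \<open>(L - M)!\<close> is what remains of the square roots in \<open>Y\<^sub>L\<^sub>M\<close> and in the Clebsch-Gordan coefficient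
  after they are multiplied.
\<close>

definition scaled_legendre :: "nat \<Rightarrow> int \<Rightarrow> real \<Rightarrow> real" where
  "scaled_legendre L M \<theta> = (if 0 \<le> M then 1 else parity M) * fact (L - nat \<bar>M\<bar>) * assoc_legendre_cos L (nat \<bar>M\<bar>) \<theta>"

lemma scaled_legendre_minus: "scaled_legendre L (- M) \<theta> = parity M * scaled_legendre L M \<theta>"
  by (auto simp: scaled_legendre_def parity_def)

lemma DERIV_scaled_legendre_nat:
  assumes "m \<le> L"
  shows "(scaled_legendre L (int m) has_real_derivative
     ((real L - real m) * scaled_legendre L (int m + 1) \<theta> - (real L + real m) * scaled_legendre L (int m - 1) \<theta>) / 2) (at \<theta>)"
proof (cases m)
  case 0
  have 1: "scaled_legendre L (int m) = (\<lambda>\<theta>. fact L * assoc_legendre_cos L 0 \<theta>)"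
    by (simp add: 0 scaled_legendre_def fun_eq_iff)
  have 2: "real L * fact (L - Suc 0) * x = fact L * x \<or> L = 0" for x :: real
    by (cases L) auto
  have 3: "assoc_legendre_cos 0 1 \<theta> = 0" by (simp add: assoc_legendre_cos_def)
  \<comment> \<open>For \<open>m = 0\<close> the neighbour of order \<open>- 1\<close> is the
    negative of that of order \<open>1\<close>, so the two halves add up. At \<open>L = 0\<close>
    the left side is 0, and so is \<open>assoc_legendre_cos 0 1 \<theta>\<close>.\<close>
  have "((real L - real m) * scaled_legendre L (int m + 1) \<theta> - (real L + real m) * scaled_legendre L (int m - 1) \<theta>) / 2
     = fact L * assoc_legendre_cos L 1 \<theta>"
    using 2[of "assoc_legendre_cos L 1 \<theta>"] 3
    by (auto simp: 0 scaled_legendre_def parity_def)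
  then show ?thesis
    unfolding 1 by (auto intro!: derivative_eq_intros DERIV_assoc_legendre_cos_0)
next
  case (Suc k)
  have k: "k < L" using assms Suc by simp
  then have f: "(fact (L - k) :: real) = (real L - real k) * fact (L - Suc k)"
    by (simp add: fact_reduce[of "L - k"])
  have g: "(real L - real k - 1) * fact (L - Suc (Suc k)) * x = fact (L - Suc k) * x \<or> L = Suc k" for x :: real
    using k by (cases "L = Suc k") (auto simp: fact_reduce[of "L - Suc k"])
  have n: "nat (1 + (1 + int k)) = Suc (Suc k)" "nat (1 + int k) = Suc k" "nat (int k + 2) = Suc (Suc k)"
    by auto
  have 1: "scaled_legendre L (int m) = (\<lambda>\<theta>. fact (L - Suc k) * assoc_legendre_cos L (Suc k) \<theta>)"
    by (simp add: Suc scaled_legendre_def fun_eq_iff n)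
  have "(scaled_legendre L (int m) has_real_derivative
      fact (L - Suc k) * ((assoc_legendre_cos L (Suc (Suc k)) \<theta>
        - (real L + real k + 1) * (real L - real k) * assoc_legendre_cos L k \<theta>) / 2)) (at \<theta>)"
    unfolding 1 by (rule DERIV_cmult[OF DERIV_assoc_legendre_cos_Suc])
  moreover have r1: "fact (L - Suc k) * assoc_legendre_cos L (Suc (Suc k)) \<theta> =
      (real L - real m) * scaled_legendre L (int m + 1) \<theta>"
  proof (cases "L = Suc k")
    case True
    \<comment> \<open>Here the factor \<open>L - m\<close> is 0, so the Legendre function of order
      \<open>L + 1\<close> must vanish by itself: \<open>rodrigues L (2 * L)\<close> is a constant,
      and one more derivative kills it.\<close>
    have "degree (([:-1, 0, 1:] :: real poly) ^ L) \<le> 2 * L"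
      by (rule order_trans[OF degree_power_le]) simp
    then have "degree (rodrigues L n) \<le> 2 * L - n" for n
      by (induction n) (auto simp: rodrigues_def degree_pderiv)
    from this[of "2 * L"] have "pderiv (rodrigues L (2 * L)) = 0"
      by (simp add: pderiv_eq_0_iff)
    then have "rodrigues L (L + Suc (Suc k)) = 0"
      by (simp add: True pderiv_rodrigues mult_2)
    then have "assoc_legendre_cos L (Suc (Suc k)) \<theta> = 0"
      by (simp add: assoc_legendre_cos_rodrigues)
    then show ?thesis using True Suc by simp
  next
    case False
    then show ?thesis using g[of "assoc_legendre_cos L (Suc (Suc k)) \<theta>"]
      by (simp add: Suc scaled_legendre_def n algebra_simps)
  qed
  moreover have r2: "fact (L - Suc k) * ((real L + real k + 1) * (real L - real k) * assoc_legendre_cos L k \<theta>) =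
      (real L + real m) * scaled_legendre L (int m - 1) \<theta>"
    by (simp add: Suc scaled_legendre_def f)
  ultimately show ?thesis
    unfolding r1[symmetric] r2[symmetric] by (simp only: times_divide_eq_right right_diff_distrib)
qed

text \<open>Negative orders reduce to positive ones by \<open>scaled_legendre_minus\<close>, which
  exchanges the two neighbours. With this scaling the coefficients \<open>L - M\<close> and
  \<open>L + M\<close> are exactly those of \<open>cg_sum_lower\<close> and
  \<open>cg_sum_raise\<close>.\<close>

lemma DERIV_scaled_legendre:
  assumes "\<bar>M\<bar> \<le> int L"
  shows "(scaled_legendre L M has_real_derivative
     (of_int (int L - M) * scaled_legendre L (M + 1) \<theta> - of_int (int L + M) * scaled_legendre L (M - 1) \<theta>) / 2) (at \<theta>)"
proof (cases "0 \<le> M")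
  case True
  then show ?thesis using DERIV_scaled_legendre_nat[of "nat M" L \<theta>] assms by simp
next
  case False
  define m where "m = nat (- M)"
  have m: "M = - int m" using False by (simp add: m_def)
  have 1: "scaled_legendre L M = (\<lambda>\<theta>. parity M * scaled_legendre L (int m) \<theta>)"
    using scaled_legendre_minus[of L "int m"] by (simp add: m fun_eq_iff parity_def)
  have 2: "scaled_legendre L (M + 1) \<theta> = - parity M * scaled_legendre L (int m - 1) \<theta>"
    "scaled_legendre L (M - 1) \<theta> = - parity M * scaled_legendre L (int m + 1) \<theta>"
    using scaled_legendre_minus[of L "int m - 1" \<theta>] scaled_legendre_minus[of L "int m + 1" \<theta>]
    by (auto simp: m parity_def)
  show ?thesis
    unfolding 1 2
    by (rule DERIV_cong[OF DERIV_cmult[OF DERIV_scaled_legendre_nat]])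
      (use assms in \<open>auto simp: m algebra_simps\<close>)
qed

subsection \<open>The polar rotation of the kernel\<close>

text \<open>The factors that do not depend on the order: the prefactor of the kernel, the
  normalizations of the spherical harmonic and of the tensor operator, and the first root in Racah's
  formula.\<close>

definition coupling :: "nat \<Rightarrow> nat \<Rightarrow> real" where
  "coupling N L = sqrt (4 * pi / (real N + 1)) * sqrt ((2 * real L + 1) / (4 * pi)) * sqrt ((2 * real L + 1) / (real N + 1)) *
     sqrt ((real N + 1) * fact (N - L) * fact L * fact L / fact (N + L + 1))"

text \<open>The product \<open>(j - m)! (j + m)!\<close> from the second root in Racah's formula,
  for \<open>m = j - a\<close>.\<close>

definition weight :: "nat \<Rightarrow> int \<Rightarrow> real" where
  "weight N a = fact (nat a) * fact (N - nat a)"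

text \<open>Entry of the kernel after conjugation by the phases and the square roots of
  \<open>weight\<close>. This turns the symmetric factor
  \<open>sqrt (weight N a' * weight N a)\<close> into \<open>weight N a\<close>, so that no root
  depends on the indices.\<close>

definition radial :: "nat \<Rightarrow> real \<Rightarrow> int \<Rightarrow> int \<Rightarrow> real" where
  "radial N \<theta> a' a = (\<Sum>L\<le>N. coupling N L * scaled_legendre L (a - a') \<theta> * (weight N a * cg_sum (int N) L a' a))"

lemma radial_eq_0:
  "a' < 0 \<or> a < 0 \<or> int N < a' \<or> int N < a \<Longrightarrow> radial N \<theta> a' a = 0"
  unfolding radial_def by (intro sum.neutral ballI) (subst cg_sum_eq_0, auto)

text \<open>From \<open>(N - a) (a + 1)! (N - a - 1)! = (a + 1) a! (N - a)!\<close>. The factor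
  \<open>cg_sum\<close> is carried along to settle \<open>a = N\<close>, where it vanishes.\<close>

lemma weight_up:
  assumes "0 \<le> a" "a \<le> int N"
  shows "of_int (int N - a) * (weight N (a + 1) * cg_sum (int N) L a' (a + 1)) =
    weight N a * (of_int (a + 1) * cg_sum (int N) L a' (a + 1))"
proof (cases "a = int N")
  case True
  then show ?thesis by (simp add: cg_sum_eq_0)
next
  case False
  define n where "n = nat a"
  have n: "a = int n" "n < N" using assms False by (auto simp: n_def)
  then have "(fact (N - n) :: real) = real (N - n) * fact (N - Suc n)"
    by (simp add: fact_reduce[of "N - n"])
  moreover have "nat (int n + 1) = Suc n" "nat (1 + int n) = Suc n" by auto
  ultimately show ?thesis using n by (simp add: weight_def of_nat_diff)
qed

lemma weight_down:
  assumes "0 \<le> a" "a \<le> int N"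
  shows "of_int a * (weight N (a - 1) * cg_sum (int N) L a' (a - 1)) =
    weight N a * (of_int (int N - a + 1) * cg_sum (int N) L a' (a - 1))"
proof (cases "a = 0")
  case True
  then show ?thesis by (simp add: cg_sum_eq_0)
next
  case False
  then obtain n where n: "a = int (Suc n)" "Suc n \<le> N"
    using assms by (metis (no_types) Suc_pred' nat_int nat_0_le of_nat_0 of_nat_le_iff neq0_conv)
  then have "(fact (N - n) :: real) = real (N - n) * fact (N - Suc n)"
    by (simp add: fact_reduce[of "N - n"])
  moreover have "nat (1 + int n) = Suc n" "nat (int n + 1) = Suc n" by auto
  ultimately show ?thesis using n by (simp add: weight_def of_nat_diff)
qed

text \<open>Heisenberg's equation entrywise, degree by degree: differentiation moves the order
  \<open>M = a - a'\<close> to \<open>M + 1\<close> and \<open>M - 1\<close> with coefficients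
  \<open>L - M\<close> and \<open>L + M\<close>, and the ladder relations absorb these into
  neighbouring entries.\<close>

lemma DERIV_radial:
  assumes "0 \<le> a" "a \<le> int N"
  shows "((\<lambda>\<theta>. radial N \<theta> a' a) has_real_derivative
     (of_int (int N - a' + 1) * radial N \<theta> (a' - 1) a - of_int (a' + 1) * radial N \<theta> (a' + 1) a
      - of_int (int N - a) * radial N \<theta> a' (a + 1) + of_int a * radial N \<theta> a' (a - 1)) / 2) (at \<theta>)"
proof -
  let ?g = "\<lambda>L M. scaled_legendre L M \<theta>" and ?S = "cg_sum (int N)" and ?M = "a - a'"
  have deriv: "((\<lambda>\<theta>. coupling N L * scaled_legendre L ?M \<theta> * (weight N a * ?S L a' a)) has_real_derivative
     coupling N L * ((of_int (int L - ?M) * ?g L (?M + 1) - of_int (int L + ?M) * ?g L (?M - 1)) / 2) * (weight N a * ?S L a' a)) (at \<theta>)" for L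
  proof (cases "\<bar>?M\<bar> \<le> int L")
    case True
    show ?thesis
      by (rule DERIV_cmult_right[OF DERIV_cmult[OF DERIV_scaled_legendre[OF True]]])
  next
    case False
    \<comment> \<open>Orders beyond \<open>L\<close> are outside the reach of
      \<open>DERIV_scaled_legendre\<close>, but \<open>cg_sum\<close> is 0 there and both sides
      vanish.\<close>
    then show ?thesis by (simp add: cg_sum_eq_0)
  qed
  have shift: "a - (a' - 1) = ?M + 1" "a - (a' + 1) = ?M - 1" "a + 1 - a' = ?M + 1" "a - 1 - a' = ?M - 1" by simp_all
  \<comment> \<open>The entries at \<open>a' - 1\<close> and \<open>a + 1\<close> have order
    \<open>M + 1\<close>, those at \<open>a' + 1\<close> and \<open>a - 1\<close> have order
    \<open>M - 1\<close>; this decides which Legendre factor goes with which neighbour.\<close>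
  have "coupling N L * ((of_int (int L - ?M) * ?g L (?M + 1) - of_int (int L + ?M) * ?g L (?M - 1)) / 2) * (weight N a * ?S L a' a) =
    (of_int (int N - a' + 1) * (coupling N L * ?g L (?M + 1) * (weight N a * ?S L (a' - 1) a))
     - of_int (a' + 1) * (coupling N L * ?g L (?M - 1) * (weight N a * ?S L (a' + 1) a))
     - of_int (int N - a) * (coupling N L * ?g L (?M + 1) * (weight N (a + 1) * ?S L a' (a + 1)))
     + of_int a * (coupling N L * ?g L (?M - 1) * (weight N (a - 1) * ?S L a' (a - 1)))) / 2" for L
  proof -
    have up: "of_int (int L - ?M) * ?S L a' a =
        of_int (int N - a' + 1) * ?S L (a' - 1) a - of_int (a + 1) * ?S L a' (a + 1)"
      using cg_sum_lower[of "int N" a' L a] by (simp add: algebra_simps)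
    have dn: "of_int (int L + ?M) * ?S L a' a =
        of_int (a' + 1) * ?S L (a' + 1) a - of_int (int N - a + 1) * ?S L a' (a - 1)"
      using cg_sum_raise[of a' "int N" L a] by (simp add: algebra_simps)
    have "coupling N L * ((of_int (int L - ?M) * ?g L (?M + 1) - of_int (int L + ?M) * ?g L (?M - 1)) / 2) * (weight N a * ?S L a' a) =
      coupling N L * weight N a * (?g L (?M + 1) * (of_int (int L - ?M) * ?S L a' a)
         - ?g L (?M - 1) * (of_int (int L + ?M) * ?S L a' a)) / 2"
      by (simp only: algebra_simps times_divide_eq_right times_divide_eq_left)
    also have "\<dots> = (coupling N L * ?g L (?M + 1) * (of_int (int N - a' + 1) * (weight N a * ?S L (a' - 1) a)
         - weight N a * (of_int (a + 1) * ?S L a' (a + 1)))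
       - coupling N L * ?g L (?M - 1) * (of_int (a' + 1) * (weight N a * ?S L (a' + 1) a)
         - weight N a * (of_int (int N - a + 1) * ?S L a' (a - 1)))) / 2"
      unfolding up dn by (simp only: algebra_simps)
    finally show ?thesis
      unfolding weight_up[OF assms, symmetric] weight_down[OF assms, symmetric]
      by (simp only: algebra_simps)
  qed
  note eq = this
  show ?thesis
    unfolding radial_def shift
    by (rule DERIV_cong[OF DERIV_sum[OF deriv]])
      (simp only: eq sum_distrib_left sum_subtractf[symmetric] sum.distrib[symmetric] sum_divide_distrib)
qed

section \<open>The derivative of the radial matrix as a commutator\<close>

definition radial_mat :: "nat \<Rightarrow> real \<Rightarrow> real mat" where
  "radial_mat N \<theta> = mat (N + 1) (N + 1) (\<lambda>(i, j). radial N \<theta> (int i) (int j))"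

text \<open>
  This is \<open>- i J\<^sub>y\<close>, conjugated by the diagonal matrix of the square roots of \<open>weight\<close>, which
  removes the square roots from \<open>J\<^sub>+\<close> and \<open>J\<^sub>-\<close>.
\<close>

definition rotation_generator :: "nat \<Rightarrow> real mat" where
  "rotation_generator N = mat (N + 1) (N + 1)
     (\<lambda>(i, j). (if i = j + 1 then (real N - real j) / 2 else 0) - (if j = i + 1 then real j / 2 else 0))"

lemma index_mult_mat_sum:
  assumes "A \<in> carrier_mat n m" "B \<in> carrier_mat m p" "i < n" "j < p"
  shows "(A * B) $$ (i, j) = (\<Sum>k<m. A $$ (i, k) * B $$ (k, j))"
  using assms by (auto simp: scalar_prod_def lessThan_atLeast0 intro!: sum.cong)

lemma sum_if_eq_Suc:
  fixes i n :: nat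
  shows "(\<Sum>b<n. if i = b + 1 then f b else 0) = (if 1 \<le> i \<and> i \<le> n then f (i - 1) else (0 :: real))"
proof (cases i)
  case (Suc k)
  then show ?thesis by (simp add: sum.delta' Suc_le_eq)
qed simp

lemma radial_mat_carrier: "radial_mat N \<theta> \<in> carrier_mat (N + 1) (N + 1)"
  by (simp add: radial_mat_def)

lemma rotation_generator_carrier: "rotation_generator N \<in> carrier_mat (N + 1) (N + 1)"
  by (simp add: rotation_generator_def)

lemma DERIV_radial_mat:
  assumes i: "i < N + 1" and j: "j < N + 1"
  shows "((\<lambda>\<theta>. radial_mat N \<theta> $$ (i, j)) has_real_derivative
    (rotation_generator N * radial_mat N \<theta> - radial_mat N \<theta> * rotation_generator N) $$ (i, j)) (at \<theta>)"
proof -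
  let ?R = "radial N \<theta>"
  have "(rotation_generator N * radial_mat N \<theta>) $$ (i, j) =
      (\<Sum>b<N + 1. ((if i = b + 1 then (real N - real b) / 2 else 0) - (if b = i + 1 then real b / 2 else 0)) * ?R (int b) (int j))"
    using i j unfolding index_mult_mat_sum[OF rotation_generator_carrier radial_mat_carrier i j]
    by (intro sum.cong) (auto simp: rotation_generator_def radial_mat_def)
  also have "\<dots> = (\<Sum>b<N + 1. if i = b + 1 then (real N - real b) / 2 * ?R (int b) (int j) else 0)
      - (\<Sum>b<N + 1. if b = i + 1 then real b / 2 * ?R (int b) (int j) else 0)"
    by (simp only: sum_subtractf[symmetric]) (rule sum.cong, auto simp: algebra_simps)
  \<comment> \<open>At the border the sum is empty while the right side refers to index
    \<open>- 1\<close>, where \<open>radial\<close> is 0. The three sums below are settled alike,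
    with index \<open>N + 1\<close> at the upper border.\<close>
  also have "(\<Sum>b<N + 1. if i = b + 1 then (real N - real b) / 2 * ?R (int b) (int j) else 0) =
      (real N - real i + 1) / 2 * ?R (int i - 1) (int j)"
    unfolding sum_if_eq_Suc using i by (cases i) (auto simp: radial_eq_0)
  also have "(\<Sum>b<N + 1. if b = i + 1 then real b / 2 * ?R (int b) (int j) else 0) =
      (real i + 1) / 2 * ?R (int i + 1) (int j)"
    by (subst sum.delta) (use i in \<open>auto simp: radial_eq_0 add.commute\<close>)
  finally have 1: "(rotation_generator N * radial_mat N \<theta>) $$ (i, j) =
      (real N - real i + 1) / 2 * ?R (int i - 1) (int j) - (real i + 1) / 2 * ?R (int i + 1) (int j)" .
  have "(radial_mat N \<theta> * rotation_generator N) $$ (i, j) =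
      (\<Sum>b<N + 1. ?R (int i) (int b) * ((if b = j + 1 then (real N - real j) / 2 else 0) - (if j = b + 1 then real j / 2 else 0)))"
    using i j unfolding index_mult_mat_sum[OF radial_mat_carrier rotation_generator_carrier i j]
    by (intro sum.cong) (auto simp: rotation_generator_def radial_mat_def)
  also have "\<dots> = (\<Sum>b<N + 1. if b = j + 1 then (real N - real j) / 2 * ?R (int i) (int b) else 0)
      - (\<Sum>b<N + 1. if j = b + 1 then real j / 2 * ?R (int i) (int b) else 0)"
    by (simp only: sum_subtractf[symmetric]) (rule sum.cong, auto simp: algebra_simps)
  also have "(\<Sum>b<N + 1. if j = b + 1 then real j / 2 * ?R (int i) (int b) else 0) =
      real j / 2 * ?R (int i) (int j - 1)"
    unfolding sum_if_eq_Suc using j by (cases j) (auto simp: radial_eq_0)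
  also have "(\<Sum>b<N + 1. if b = j + 1 then (real N - real j) / 2 * ?R (int i) (int b) else 0) =
      (real N - real j) / 2 * ?R (int i) (int j + 1)"
    by (subst sum.delta) (use j in \<open>auto simp: radial_eq_0 add.commute\<close>)
  finally have 2: "(radial_mat N \<theta> * rotation_generator N) $$ (i, j) =
      (real N - real j) / 2 * ?R (int i) (int j + 1) - real j / 2 * ?R (int i) (int j - 1)" .
  have "(rotation_generator N * radial_mat N \<theta> - radial_mat N \<theta> * rotation_generator N) $$ (i, j) =
      (rotation_generator N * radial_mat N \<theta>) $$ (i, j) - (radial_mat N \<theta> * rotation_generator N) $$ (i, j)"
    using i j rotation_generator_carrier[of N] radial_mat_carrier[of N \<theta>] by (intro index_minus_mat) auto
  then have "(of_int (int N - int i + 1) * ?R (int i - 1) (int j) - of_int (int i + 1) * ?R (int i + 1) (int j)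
      - of_int (int N - int j) * ?R (int i) (int j + 1) + of_int (int j) * ?R (int i) (int j - 1)) / 2 =
      (rotation_generator N * radial_mat N \<theta> - radial_mat N \<theta> * rotation_generator N) $$ (i, j)"
    unfolding 1 2 by (simp add: field_simps)
  moreover have "(\<lambda>\<theta>. radial_mat N \<theta> $$ (i, j)) = (\<lambda>\<theta>. radial N \<theta> (int i) (int j))"
    using i j by (simp add: radial_mat_def)
  ultimately show ?thesis
    using j by (simp only:) (rule DERIV_cong[OF DERIV_radial], auto)
qed

section \<open>Traces of powers along a commutator flow\<close>

lemma DERIV_pow_commutator:
  fixes R :: "real \<Rightarrow> real mat"
  assumes R: "\<And>t. R t \<in> carrier_mat n n" and A: "A \<in> carrier_mat n n"
    and deriv: "\<And>t i j. i < n \<Longrightarrow> j < n \<Longrightarrow>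
      ((\<lambda>t. R t $$ (i, j)) has_real_derivative (A * R t - R t * A) $$ (i, j)) (at t)"
    and ij: "i < n" "j < n"
  shows "((\<lambda>t. (R t ^\<^sub>m k) $$ (i, j)) has_real_derivative (A * R t ^\<^sub>m k - R t ^\<^sub>m k * A) $$ (i, j)) (at t)"
  using ij
proof (induction k arbitrary: i j)
  case 0
  have "(A * 1\<^sub>m n - 1\<^sub>m n * A) $$ (i, j) = 0" using A 0 by simp
  then show ?case using R[of t] by (simp add: carrier_matD[OF R])
next
  case (Suc k)
  let ?P = "\<lambda>t. R t ^\<^sub>m k"
  have P: "?P t \<in> carrier_mat n n" for t by (rule pow_carrier_mat[OF R])
  note prod = index_mult_mat_sum[OF _ _ Suc.prems]
  have D: "A * ?P t - ?P t * A \<in> carrier_mat n n" "A * R t - R t * A \<in> carrier_mat n n"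
    using A P[of t] R[of t] by auto
  have "((\<lambda>t. \<Sum>b<n. ?P t $$ (i, b) * R t $$ (b, j)) has_real_derivative
     (\<Sum>b<n. (A * ?P t - ?P t * A) $$ (i, b) * R t $$ (b, j) + (A * R t - R t * A) $$ (b, j) * ?P t $$ (i, b))) (at t)"
    using Suc.prems by (intro DERIV_sum DERIV_mult Suc.IH deriv) auto
  also have "(\<lambda>t. \<Sum>b<n. ?P t $$ (i, b) * R t $$ (b, j)) = (\<lambda>t. (R t ^\<^sub>m Suc k) $$ (i, j))"
    using prod[OF P R] by simp
  also have "(\<Sum>b<n. (A * ?P t - ?P t * A) $$ (i, b) * R t $$ (b, j) + (A * R t - R t * A) $$ (b, j) * ?P t $$ (i, b))
     = ((A * ?P t - ?P t * A) * R t) $$ (i, j) + (?P t * (A * R t - R t * A)) $$ (i, j)"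
    by (simp only: prod[OF D(1) R] prod[OF P D(2)] sum.distrib mult.commute[of "?P t $$ (i, _)"])
  also have "\<dots> = ((A * ?P t - ?P t * A) * R t + ?P t * (A * R t - R t * A)) $$ (i, j)"
    using Suc.prems A P[of t] R[of t] by simp
  \<comment> \<open>Commutation with \<open>A\<close> is a derivation: in the product rule the two
    middle terms \<open>?P t * (A * R t)\<close> cancel.\<close>
  also have "(A * ?P t - ?P t * A) * R t + ?P t * (A * R t - R t * A) = A * R t ^\<^sub>m Suc k - R t ^\<^sub>m Suc k * A"
  proof -
    have cancel: "X - Y + (Y - Z) = X - Z"
      if "X \<in> carrier_mat n n" "Y \<in> carrier_mat n n" "Z \<in> carrier_mat n n" for X Y Z :: "real mat"
      using that by (intro eq_matI) auto
    have c: "A * (?P t * R t) \<in> carrier_mat n n" "?P t * (A * R t) \<in> carrier_mat n n" "?P t * (R t * A) \<in> carrier_mat n n"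
      using A P[of t] R[of t] by auto
    have "(A * ?P t - ?P t * A) * R t = A * (?P t * R t) - ?P t * (A * R t)"
      using A P[of t] R[of t]
      by (subst minus_mult_distrib_mat[of _ n n]) (auto simp: assoc_mult_mat[of _ n n _ n _ n])
    moreover have "?P t * (A * R t - R t * A) = ?P t * (A * R t) - ?P t * (R t * A)"
      using A P[of t] R[of t] by (simp add: mult_minus_distrib_mat[of _ n n _ n])
    moreover have "A * (?P t * R t) - ?P t * (A * R t) + (?P t * (A * R t) - ?P t * (R t * A)) =
       A * (?P t * R t) - ?P t * (R t * A)"
      by (rule cancel[OF c])
    ultimately show ?thesis
      using A P[of t] R[of t] by (simp add: assoc_mult_mat[of _ n n _ n _ n])
  qed
  finally show ?case .
qed

text \<open>The derivative is the trace of a commutator, which is 0 by cyclicity.\<close>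

lemma trace_pow_radial_mat_const:
  "(\<Sum>i<N + 1. (radial_mat N \<theta> ^\<^sub>m k) $$ (i, i)) = (\<Sum>i<N + 1. (radial_mat N \<theta>' ^\<^sub>m k) $$ (i, i))"
proof -
  let ?n = "N + 1" and ?R = "radial_mat N" and ?A = "rotation_generator N"
  note R = radial_mat_carrier[of N] and A = rotation_generator_carrier[of N]
  have P: "?R t ^\<^sub>m k \<in> carrier_mat ?n ?n" for t by (rule pow_carrier_mat[OF R])
  have "((\<lambda>t. \<Sum>i<?n. (?R t ^\<^sub>m k) $$ (i, i)) has_real_derivative 0) (at t)" for t
  proof (rule DERIV_cong[OF DERIV_sum])
    show "((\<lambda>t. (?R t ^\<^sub>m k) $$ (i, i)) has_real_derivative (?A * ?R t ^\<^sub>m k - ?R t ^\<^sub>m k * ?A) $$ (i, i)) (at t)"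
      if "i \<in> {..<?n}" for i
      using that by (intro DERIV_pow_commutator[OF R A] DERIV_radial_mat) auto
    have "(\<Sum>i<?n. (?A * ?R t ^\<^sub>m k) $$ (i, i)) = (\<Sum>i<?n. \<Sum>b<?n. ?A $$ (i, b) * (?R t ^\<^sub>m k) $$ (b, i))"
      by (intro sum.cong refl index_mult_mat_sum[OF A P]) auto
    also have "\<dots> = (\<Sum>b<?n. \<Sum>i<?n. (?R t ^\<^sub>m k) $$ (b, i) * ?A $$ (i, b))"
      by (subst sum.swap) (simp add: mult.commute)
    also have "\<dots> = (\<Sum>b<?n. (?R t ^\<^sub>m k * ?A) $$ (b, b))"
      by (intro sum.cong refl index_mult_mat_sum[OF P A, symmetric]) auto
    moreover have "(\<Sum>i<?n. (?A * ?R t ^\<^sub>m k - ?R t ^\<^sub>m k * ?A) $$ (i, i)) =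
        (\<Sum>i<?n. (?A * ?R t ^\<^sub>m k) $$ (i, i) - (?R t ^\<^sub>m k * ?A) $$ (i, i))"
      using A P[of t] by (intro sum.cong refl index_minus_mat) auto
    ultimately show "(\<Sum>i<?n. (?A * ?R t ^\<^sub>m k - ?R t ^\<^sub>m k * ?A) $$ (i, i)) = 0"
      by (simp only: sum_subtractf)
  qed
  then show ?thesis
    using DERIV_isconst_all[of "\<lambda>t. \<Sum>i<?n. (?R t ^\<^sub>m k) $$ (i, i)"] by blast
qed

subsection \<open>Matrix elements of the Wigner kernel\<close>

lemma rfact_of_int: "x = of_int n \<Longrightarrow> rfact x = fact (nat n)"
  by (simp add: rfact_def)

lemma rfact_of_nat: "x = real n \<Longrightarrow> rfact x = fact n"
  by (simp add: rfact_def)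

lemma inv_fact_nonneg: "0 \<le> n \<Longrightarrow> inv_fact n = 1 / rfact (of_int n)"
  by (simp add: rfact_def inv_fact_def)

text \<open>Dictionary from Racah's formula to \<open>cg_sum\<close>: with
  \<open>j1 = J = N / 2\<close> all factorial arguments are integers, and the roots split into a
  part fixed by \<open>N\<close> and \<open>L\<close> and a part with the indices.\<close>

lemma clebsch_gordan_spin:
  assumes "a \<le> N" "a' \<le> N" "L \<le> N"
  shows "clebsch_gordan (real N / 2) (real N / 2 - real a) (real L) (of_int M) (real N / 2) (real N / 2 - real a') =
    (if M = int a - int a' \<and> \<bar>M\<bar> \<le> int L
     then sqrt ((real N + 1) * fact (N - L) * fact L * fact L / fact (N + L + 1)) *
       sqrt (fact (N - a') * fact a' * fact (N - a) * fact a * fact (nat (int L + M)) * fact (nat (int L - M))) *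
       cg_sum (int N) L (int a') (int a)
     else 0)"
proof (cases "M = int a - int a' \<and> \<bar>M\<bar> \<le> int L")
  case False
  then have "\<not> (real N / 2 - real a' = real N / 2 - real a + of_int M \<and> \<bar>of_int M\<bar> \<le> real L)"
    by linarith
  then show ?thesis using False by (auto simp: clebsch_gordan_def)
next
  case True
  have M: "of_int M = real a - real a'" "\<bar>of_int M\<bar> \<le> real L" using True by linarith+
  have cond: "real N / 2 - real a' = real N / 2 - real a + of_int M \<and> \<bar>real N / 2 - real a\<bar> \<le> real N / 2
     \<and> \<bar>of_int M\<bar> \<le> real L \<and> \<bar>real N / 2 - real a'\<bar> \<le> real N / 2 \<and> \<bar>real N / 2 - real L\<bar> \<le> real N / 2
     \<and> real N / 2 \<le> real N / 2 + real L"
    using M assms by (intro conjI; linarith)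
  have r1: "rfact (real N / 2 + real N / 2 - real L) = fact (N - L)"
    "rfact (real N / 2 - real N / 2 + real L) = fact L"
    "rfact (real N / 2 + real L - real N / 2) = fact L"
    "rfact (real N / 2 + real L + real N / 2 + 1) = fact (N + L + 1)"
    by (rule rfact_of_nat, use assms in \<open>simp add: of_nat_diff\<close>)+
  have r2: "rfact (real N / 2 + (real N / 2 - real a')) = fact (N - a')"
    "rfact (real N / 2 - (real N / 2 - real a')) = fact a'"
    "rfact (real N / 2 + (real N / 2 - real a)) = fact (N - a)"
    "rfact (real N / 2 - (real N / 2 - real a)) = fact a"
    "rfact (real L + of_int M) = fact (nat (int L + M))"
    "rfact (real L - of_int M) = fact (nat (int L - M))"
    using assms by (auto intro!: rfact_of_nat rfact_of_int simp: of_nat_diff)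
  let ?K = "{k :: nat. real k \<le> real N / 2 + real L - real N / 2 \<and> real k \<le> real N / 2 - (real N / 2 - real a)
     \<and> real k \<le> real L + of_int M \<and> 0 \<le> real N / 2 - real L + (real N / 2 - real a) + real k
     \<and> 0 \<le> real N / 2 - real N / 2 - of_int M + real k}"
  let ?t = "\<lambda>k. (-1) ^ k / (fact k * rfact (real N / 2 + real L - real N / 2 - real k)
     * rfact (real N / 2 - (real N / 2 - real a) - real k) * rfact (real L + of_int M - real k)
     * rfact (real N / 2 - real L + (real N / 2 - real a) + real k)
     * rfact (real N / 2 - real N / 2 - of_int M + real k)) :: real"
  \<comment> \<open>Racah's summation set consists of the \<open>k\<close> with nonnegative
    factorial arguments; elsewhere in \<open>{..L}\<close> the value of \<open>cg_term\<close> is 0,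
    so both sums agree.\<close>
  have K: "k \<in> ?K \<longleftrightarrow> 0 \<le> int L - int k \<and> 0 \<le> int a - int k \<and> 0 \<le> int L + int a - int a' - int k \<and>
      0 \<le> int N - int a - int L + int k \<and> 0 \<le> int k - int a + int a'" for k
    using True by auto
  have "cg_term (int N) (int L) (int a') (int a) (int k) = ?t k" if "k \<in> ?K" for k
  proof -
    have "rfact (real k) = fact k" by (simp add: rfact_of_int[of _ "int k"])
    moreover have "parity (int k) = (-1) ^ k" by (simp add: parity_def)
    moreover have "real N / 2 + real L - real N / 2 - real k = of_int (int L - int k)"
      "real N / 2 - (real N / 2 - real a) - real k = of_int (int a - int k)"
      "real L + of_int M - real k = of_int (int L + int a - int a' - int k)"
      "real N / 2 - real L + (real N / 2 - real a) + real k = of_int (int N - int a - int L + int k)"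
      "real N / 2 - real N / 2 - of_int M + real k = of_int (int k - int a + int a')"
      using True by auto
    ultimately show ?thesis
      using that[unfolded K] by (simp only: cg_term_def inv_fact_nonneg of_nat_0_le_iff of_int_of_nat_eq) simp
  qed
  moreover have "cg_term (int N) (int L) (int a') (int a) (int k) = 0" if "k \<notin> ?K" for k
    using that[unfolded K] by (auto simp: cg_term_def inv_fact_neg not_le)
  moreover have "?K \<subseteq> {..L}" using K by auto
  ultimately have "cg_sum (int N) L (int a') (int a) = (\<Sum>k\<in>?K. ?t k)"
    unfolding cg_sum_def by (intro sum.mono_neutral_cong_right) auto
  moreover have "2 * (real N / 2) = real N" by simp
  ultimately show ?thesis
    unfolding clebsch_gordan_def if_P[OF cond] if_P[OF True] r1 r2 by (simp only:)
qed

text \<open>Diagonal of the similarity between kernel and radial matrix: the root undoes the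
  conjugation behind \<open>radial\<close>, and the phase carries the whole dependence on the
  azimuth.\<close>

definition phase_weight :: "nat \<Rightarrow> real \<Rightarrow> nat \<Rightarrow> complex" where
  "phase_weight N \<phi> a = complex_of_real (sqrt (weight N (int a))) * cis (real a * \<phi>)"

lemma weight_pos: "0 < weight N a"
  by (simp add: weight_def)

lemma phase_weight_nonzero: "phase_weight N \<phi> a \<noteq> 0"
  using weight_pos[of N "int a"] by (simp add: phase_weight_def)

text \<open>The root multiplied on the left comes from the Clebsch-Gordan coefficient. For
  \<open>m = \<bar>M\<bar>\<close> it cancels \<open>(L + m)!\<close> in the normalization of the
  harmonic and completes \<open>(L - m)!\<close>.\<close>

lemma cnj_sph_harm:
  assumes "\<bar>M\<bar> \<le> int L"
  shows "cnj (sph_harm L M (\<theta>, \<phi>)) * complex_of_real (sqrt (fact (nat (int L + M)) * fact (nat (int L - M)))) =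
    complex_of_real (sqrt ((2 * real L + 1) / (4 * pi)) * scaled_legendre L M \<theta>) * cis (- (of_int M * \<phi>))"
proof -
  define m where "m = nat \<bar>M\<bar>"
  have m: "m \<le> L" using assms by (simp add: m_def)
  have "sqrt (fact (nat (int L + M)) * fact (nat (int L - M))) = sqrt (fact (L + m) * fact (L - m))"
  proof (cases "0 \<le> M")
    case True
    then have "nat (int L + M) = L + m" "nat (int L - M) = L - m" using m by (auto simp: m_def)
    then show ?thesis by simp
  next
    case False
    then have "nat (int L + M) = L - m" "nat (int L - M) = L + m" using m by (auto simp: m_def)
    then show ?thesis by (simp add: mult.commute)
  qed
  moreover have "sqrt ((2 * real L + 1) / (4 * pi) * fact (L - m) / fact (L + m)) * sqrt (fact (L + m) * fact (L - m)) =
      sqrt ((2 * real L + 1) / (4 * pi)) * fact (L - m)"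
    by (simp add: real_sqrt_mult real_sqrt_divide)
  then have "complex_of_real (sqrt ((2 * real L + 1) / (4 * pi) * fact (L - m) / fact (L + m))) *
      complex_of_real (sqrt (fact (L + m) * fact (L - m))) =
      complex_of_real (sqrt ((2 * real L + 1) / (4 * pi)) * fact (L - m))"
    by (metis of_real_mult)
  moreover have "cnj (sph_harm L M (\<theta>, \<phi>)) =
      complex_of_real (sqrt ((2 * real L + 1) / (4 * pi) * fact (L - m) / fact (L + m))) *
      complex_of_real ((if 0 \<le> M then 1 else parity M) * assoc_legendre_cos L m \<theta>) * cis (- (of_int M * \<phi>))"
    by (auto simp: sph_harm_def sph_harm_nonneg_def m_def cis_cnj parity_def even_nat_iff)
  ultimately show ?thesis
    by (simp add: scaled_legendre_def m_def[symmetric] mult_ac)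
qed

lemma wigner_kernel_entry:
  assumes "a \<le> N" "a' \<le> N"
  shows "wigner_kernel N (\<theta>, \<phi>) $$ (a', a) =
    phase_weight N \<phi> a' * complex_of_real (radial N \<theta> (int a') (int a)) / phase_weight N \<phi> a"
proof -
  let ?M = "int a - int a'"
  define e where "e = cis (- (of_int ?M * \<phi>))"
  have summand: "complex_of_real (sqrt (4 * pi / (real N + 1))) *
      (\<Sum>M = - int L..int L. cnj (sph_harm L M (\<theta>, \<phi>)) * tensor_op N L M $$ (a', a)) =
    complex_of_real (coupling N L * scaled_legendre L ?M \<theta> * cg_sum (int N) L (int a') (int a) *
      (sqrt (weight N (int a')) * sqrt (weight N (int a)))) * e" if L: "L \<le> N" for L
  proof (cases "\<bar>?M\<bar> \<le> int L")
    case True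
    let ?C = "sqrt ((2 * real L + 1) / (real N + 1)) * sqrt ((real N + 1) * fact (N - L) * fact L * fact L / fact (N + L + 1))"
    have T: "tensor_op N L M $$ (a', a) = (if M = ?M
       then complex_of_real (sqrt (fact (nat (int L + M)) * fact (nat (int L - M)))) *
        complex_of_real (?C * (sqrt (weight N (int a')) * sqrt (weight N (int a))) * cg_sum (int N) L (int a') (int a))
       else 0)" for M
      using assms True clebsch_gordan_spin[OF assms L, of M]
      by (simp add: tensor_op_def weight_def real_sqrt_mult mult_ac)
    \<comment> \<open>Conservation of the magnetic number leaves the single order
      \<open>a - a'\<close>.\<close>
    have "(\<Sum>M = - int L..int L. cnj (sph_harm L M (\<theta>, \<phi>)) * tensor_op N L M $$ (a', a)) =
      cnj (sph_harm L ?M (\<theta>, \<phi>)) * tensor_op N L ?M $$ (a', a)"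
      using True by (subst sum.remove[of _ ?M]) (auto simp: T intro!: sum.neutral)
    also have "\<dots> = complex_of_real (sqrt ((2 * real L + 1) / (4 * pi)) * scaled_legendre L ?M \<theta>) * e *
      complex_of_real (?C * (sqrt (weight N (int a')) * sqrt (weight N (int a))) * cg_sum (int N) L (int a') (int a))"
      unfolding T e_def cnj_sph_harm[OF True, symmetric] by simp
    finally show ?thesis
      by (simp add: coupling_def mult_ac)
  next
    case False
    have "tensor_op N L M $$ (a', a) = 0" if "M \<in> {- int L..int L}" for M
      using assms False that clebsch_gordan_spin[OF assms L, of M] by (auto simp: tensor_op_def)
    then have "(\<Sum>M = - int L..int L. cnj (sph_harm L M (\<theta>, \<phi>)) * tensor_op N L M $$ (a', a)) = 0"
      by (intro sum.neutral) auto
    then show ?thesis using False by (simp add: cg_sum_eq_0)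
  qed
  have "wigner_kernel N (\<theta>, \<phi>) $$ (a', a) = (\<Sum>L\<le>N. complex_of_real (sqrt (4 * pi / (real N + 1))) *
      (\<Sum>M = - int L..int L. cnj (sph_harm L M (\<theta>, \<phi>)) * tensor_op N L M $$ (a', a)))"
    using assms by (simp add: wigner_kernel_def sum_distrib_left)
  also have "\<dots> = (\<Sum>L\<le>N. complex_of_real (coupling N L * scaled_legendre L ?M \<theta> * cg_sum (int N) L (int a') (int a) *
      (sqrt (weight N (int a')) * sqrt (weight N (int a)))) * e)"
    by (intro sum.cong refl summand) auto
  also have "\<dots> = complex_of_real (sqrt (weight N (int a')) / sqrt (weight N (int a)) * radial N \<theta> (int a') (int a)) * e"
  proof -
    \<comment> \<open>Expanding by \<open>sqrt (weight N (int a))\<close> replaces the product of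
      roots by their quotient times the weight inside \<open>radial\<close>.\<close>
    have "sqrt (weight N (int a)) \<noteq> 0" "weight N (int a) = sqrt (weight N (int a)) * sqrt (weight N (int a))"
      using weight_pos[of N "int a"] by simp_all
    then have "coupling N L * scaled_legendre L ?M \<theta> * cg_sum (int N) L (int a') (int a) *
      (sqrt (weight N (int a')) * sqrt (weight N (int a))) =
      sqrt (weight N (int a')) / sqrt (weight N (int a)) *
      (coupling N L * scaled_legendre L ?M \<theta> * (weight N (int a) * cg_sum (int N) L (int a') (int a)))" for L
      by (simp add: field_simps)
    then show ?thesis
      unfolding radial_def sum_distrib_left of_real_sum sum_distrib_right by simp
  qed
  also have "e = cis (real a' * \<phi>) / cis (real a * \<phi>)"
    by (simp add: e_def cis_divide algebra_simps)
  finally show ?thesis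
    by (simp add: phase_weight_def)
qed

text \<open>The signs from \<open>scaled_legendre_minus\<close> and \<open>cg_sum_swap\<close>
  cancel. This symmetry up to weights yields the hermiticity of the kernel.\<close>

lemma radial_swap: "weight N a' * radial N \<theta> a' a = weight N a * radial N \<theta> a a'"
proof -
  have "scaled_legendre L (a' - a) \<theta> * cg_sum (int N) L a a' = scaled_legendre L (a - a') \<theta> * cg_sum (int N) L a' a" for L
    using scaled_legendre_minus[of L "a - a'" \<theta>] cg_sum_swap[of "int N" L a a']
    by (simp add: parity_def split: if_splits)
  then show ?thesis
    unfolding radial_def sum_distrib_left by (intro sum.cong refl) (simp add: mult_ac)
qed

lemma wigner_kernel_carrier: "wigner_kernel N \<Omega> \<in> carrier_mat (N + 1) (N + 1)"
  by (simp add: wigner_kernel_def)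

lemma wigner_kernel_hermitian:
  assumes "i < N + 1" "j < N + 1"
  shows "cnj (wigner_kernel N \<Omega> $$ (j, i)) = wigner_kernel N \<Omega> $$ (i, j)"
proof -
  obtain \<theta> \<phi> where \<Omega>: "\<Omega> = (\<theta>, \<phi>)" by (cases \<Omega>)
  define r where "r = (\<lambda>a. sqrt (weight N (int a)))"
  have r: "r a \<noteq> 0" "weight N (int a) = r a * r a" for a
    using weight_pos[of N "int a"] by (simp_all add: r_def)
  \<comment> \<open>\<open>radial_swap\<close> divided by \<open>r i * r j\<close>: the real factor
    of the entry is symmetric, so conjugation affects the phases only.\<close>
  have "r j / r i * radial N \<theta> (int j) (int i) = r i / r j * radial N \<theta> (int i) (int j)"
    using radial_swap[of N "int j" \<theta> "int i"] r(1) unfolding r(2) by (simp add: field_simps)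
  then have "complex_of_real (r j / r i * radial N \<theta> (int j) (int i)) = complex_of_real (r i / r j * radial N \<theta> (int i) (int j))"
    by simp
  moreover have "cnj (cis x) = 1 / cis x" for x
    by (simp add: cis_cnj cis_divide flip: cis_zero)
  moreover have "sqrt (weight N (int a)) = r a" for a by (simp add: r_def)
  then have "wigner_kernel N \<Omega> $$ (a', a) = cis (real a' * \<phi>) / cis (real a * \<phi>) *
      complex_of_real (r a' / r a * radial N \<theta> (int a') (int a))" if "a \<le> N" "a' \<le> N" for a a'
    using that by (simp add: \<Omega> wigner_kernel_entry phase_weight_def mult_ac)
  ultimately show ?thesis
    using assms by (simp del: of_real_mult of_real_divide)
qed

lemma wigner_kernel_similar:
  "\<exists>P Q. similar_mat_wit (wigner_kernel N (\<theta>, \<phi>)) (map_mat complex_of_real (radial_mat N \<theta>)) P Q"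
proof -
  define n where "n = N + 1"
  let ?d = "phase_weight N \<phi>" and ?R = "map_mat complex_of_real (radial_mat N \<theta>)"
  have R: "?R \<in> carrier_mat n n" and W: "wigner_kernel N (\<theta>, \<phi>) \<in> carrier_mat n n"
    using radial_mat_carrier[of N \<theta>] wigner_kernel_carrier[of N "(\<theta>, \<phi>)"] by (auto simp: n_def)
  have "similar_mat_wit (wigner_kernel N (\<theta>, \<phi>)) ?R (mat_diag n ?d) (mat_diag n (\<lambda>i. 1 / ?d i))"
  proof (rule similar_mat_witI)
    show "mat_diag n ?d * mat_diag n (\<lambda>i. 1 / ?d i) = 1\<^sub>m n" "mat_diag n (\<lambda>i. 1 / ?d i) * mat_diag n ?d = 1\<^sub>m n"
      using phase_weight_nonzero[of N \<phi>] by simp_all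
    show "wigner_kernel N (\<theta>, \<phi>) = mat_diag n ?d * ?R * mat_diag n (\<lambda>i. 1 / ?d i)"
      unfolding mat_diag_mult_left[OF R]
      using R W by (intro eq_matI, subst mat_diag_mult_right[of _ n n])
        (auto simp: wigner_kernel_entry radial_mat_def mat_diag_def n_def less_Suc_eq_le)
  qed (use R W in auto)
  then show ?thesis by blast
qed

subsection \<open>Unitary diagonalization\<close>

lemma dim_mat_adjoint [simp]: "dim_row (mat_adjoint A) = dim_col A" "dim_col (mat_adjoint A) = dim_row A"
  by (simp_all add: mat_adjoint_def)

lemma mat_adjoint_carrier: "A \<in> carrier_mat n m \<Longrightarrow> mat_adjoint A \<in> carrier_mat m n"
  by (intro carrier_matI) auto

lemma index_mat_adjoint:
  "i < dim_col A \<Longrightarrow> j < dim_row A \<Longrightarrow> mat_adjoint A $$ (i, j) = cnj (A $$ (j, i))"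
  by (simp add: mat_adjoint_def mat_of_rows_index)

lemma mat_adjoint_adjoint: "mat_adjoint (mat_adjoint A) = (A :: complex mat)"
  by (intro eq_matI) (auto simp: index_mat_adjoint)

lemma mat_adjoint_mult:
  assumes "A \<in> carrier_mat n m" "B \<in> carrier_mat m p"
  shows "mat_adjoint (A * B) = mat_adjoint B * (mat_adjoint A :: complex mat)"
proof (rule eq_matI)
  fix i j assume "i < dim_row (mat_adjoint B * mat_adjoint A)" "j < dim_col (mat_adjoint B * mat_adjoint A)"
  then have ij: "i < p" "j < n" using assms by auto
  show "mat_adjoint (A * B) $$ (i, j) = (mat_adjoint B * mat_adjoint A) $$ (i, j)"
    using assms ij
    unfolding index_mult_mat_sum[OF mat_adjoint_carrier[OF assms(2)] mat_adjoint_carrier[OF assms(1)] ij]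
    by (simp add: index_mat_adjoint index_mult_mat_sum[OF assms ij(2,1)] mult.commute del: index_mult_mat(1))
qed (use assms in auto)

definition unitary :: "nat \<Rightarrow> complex mat \<Rightarrow> bool" where
  "unitary n U \<longleftrightarrow> U \<in> carrier_mat n n \<and> mat_adjoint U * U = 1\<^sub>m n"

lemma unitaryD:
  assumes "unitary n U"
  shows "U \<in> carrier_mat n n" "mat_adjoint U \<in> carrier_mat n n" "mat_adjoint U * U = 1\<^sub>m n" "U * mat_adjoint U = 1\<^sub>m n"
proof -
  show U: "U \<in> carrier_mat n n" "mat_adjoint U * U = 1\<^sub>m n" using assms by (auto simp: unitary_def)
  show U': "mat_adjoint U \<in> carrier_mat n n" by (rule mat_adjoint_carrier[OF U(1)])
  show "U * mat_adjoint U = 1\<^sub>m n" by (rule mat_mult_left_right_inverse[OF U'(1) U(1,2)])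
qed

lemma unitary_adjoint:
  assumes "unitary n U"
  shows "unitary n (mat_adjoint U)"
  unfolding unitary_def mat_adjoint_adjoint using unitaryD(2,4)[OF assms] ..

lemma unitary_mult:
  assumes U: "unitary n U" and V: "unitary n V"
  shows "unitary n (U * V)"
proof -
  note u = unitaryD[OF U] and v = unitaryD[OF V]
  have "mat_adjoint (U * V) * (U * V) = mat_adjoint V * (mat_adjoint U * U) * V"
    using u(1,2) v(1,2) by (simp add: mat_adjoint_mult[of _ n n _ n] assoc_mult_mat[of _ n n _ n _ n])
  then show ?thesis using u v by (simp add: unitary_def)
qed

section \<open>Spectral theorem by deflation\<close>

lemma vec_cscalar_self:
  fixes v :: "complex vec"
  shows "v \<bullet>c v = complex_of_real (\<Sum>k<dim_vec v. (cmod (v $ k))\<^sup>2)"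
  by (simp add: scalar_prod_def lessThan_atLeast0 complex_norm_square del: of_real_power)

text \<open>Complete \<open>v\<close> to a basis, orthogonalize and normalize; Gram-Schmidt leaves
  the first vector alone, so column 0 stays a multiple of \<open>v\<close>.\<close>

lemma unitary_completion:
  fixes v :: "complex vec"
  assumes v: "v \<in> carrier_vec n" "v \<noteq> 0\<^sub>v n" and n: "0 < n"
  obtains W c where "unitary n W" "col W 0 = c \<cdot>\<^sub>v v"
proof -
  interpret cof_vec_space n "TYPE(complex)" .
  define ws where "ws = gram_schmidt n (basis_completion v)"
  note b = basis_completion[OF v]
  have ws: "corthogonal ws" "set ws \<subseteq> carrier_vec n" "length ws = n"
    using gram_schmidt_result[OF b(2,4,5) refl] b(6) by (auto simp: ws_def)
  have hd: "ws ! 0 = v"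
  proof -
    obtain vs where "basis_completion v = v # vs"
      using b(6,7) n by (cases "basis_completion v") auto
    then have "hd ws = v" using v(1) by (simp add: ws_def)
    then show ?thesis using ws(3) n by (cases ws) auto
  qed
  define s where "s = (\<lambda>i. complex_of_real (sqrt (\<Sum>k<n. (cmod (ws ! i $ k))\<^sup>2)))"
  define W where "W = mat n n (\<lambda>(k, i). ws ! i $ k / s i)"
  have dimw: "dim_vec (ws ! i) = n" if "i < n" for i
    using ws(2,3) that by (meson carrier_vecD nth_mem subsetD)
  have s2: "ws ! i \<bullet>c ws ! i = s i * s i" if "i < n" for i
  proof -
    have "0 \<le> (\<Sum>k<n. (cmod (ws ! i $ k))\<^sup>2)" by (intro sum_nonneg) auto
    then show ?thesis unfolding vec_cscalar_self dimw[OF that] s_def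
      by (metis of_real_mult real_sqrt_mult_self abs_of_nonneg)
  qed
  have s0: "s i \<noteq> 0" if "i < n" for i
    using s2[OF that] corthogonalD[OF ws(1), of i i] that ws(3) by auto
  have "mat_adjoint W * W = 1\<^sub>m n"
  proof (rule eq_matI)
    fix i j assume "i < dim_row (1\<^sub>m n)" "j < dim_col (1\<^sub>m n)"
    then have ij: "i < n" "j < n" by auto
    have Wc: "W \<in> carrier_mat n n" by (simp add: W_def)
    have cs: "cnj (s i) = s i" for i by (simp add: s_def)
    have "(mat_adjoint W * W) $$ (i, j) = (\<Sum>k<n. ws ! j $ k * cnj (ws ! i $ k)) / (s i * s j)"
      unfolding index_mult_mat_sum[OF mat_adjoint_carrier[OF Wc] Wc ij] sum_divide_distrib
      using ij by (intro sum.cong) (auto simp: index_mat_adjoint W_def cs)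
    also have "(\<Sum>k<n. ws ! j $ k * cnj (ws ! i $ k)) = ws ! j \<bullet>c ws ! i"
      using dimw ij by (simp add: scalar_prod_def lessThan_atLeast0)
    also have "ws ! j \<bullet>c ws ! i / (s i * s j) = (if i = j then 1 else 0)"
      using corthogonalD[OF ws(1), of j i] ij ws(3) s2 s0 by auto
    finally show "(mat_adjoint W * W) $$ (i, j) = 1\<^sub>m n $$ (i, j)" using ij by simp
  qed (auto simp: W_def)
  then have "unitary n W" by (simp add: unitary_def W_def)
  moreover have "col W 0 = (1 / s 0) \<cdot>\<^sub>v v"
    using n v(1) dimw[of 0] by (intro eq_vecI) (auto simp: W_def hd)
  ultimately show ?thesis by (rule that)
qed

text \<open>An eigenvector for the first eigenvalue becomes the first column of a unitary matrix,
  hermiticity splits off a 1 by 1 block, and induction treats the rest. The diagonal keeps the order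
  of \<open>es\<close>, on which the sorting arguments rely.\<close>

lemma hermitian_unitary_diagonalization:
  assumes "A \<in> carrier_mat n n" "mat_adjoint A = A" "char_poly A = (\<Prod>e\<leftarrow>es. [:- e, 1:])"
  obtains U where "unitary n U" "A = U * mat_diag n (\<lambda>i. es ! i) * mat_adjoint U"
proof -
  have "\<exists>U. unitary n U \<and> A = U * mat_diag n (\<lambda>i. es ! i) * mat_adjoint U"
    using assms
  proof (induction es arbitrary: n A)
    case Nil
    then have "n = 0" using degree_monic_char_poly[OF Nil(1)] by simp
    then show ?case using Nil(1) by (intro exI[of _ "1\<^sub>m 0"]) (auto simp: unitary_def intro!: eq_matI)
  next
    case (Cons e es)
    have "degree (char_poly A) = length (e # es)"
      unfolding Cons.prems(3) using degree_linear_factors[of uminus "e # es"] by simp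
    then have n: "n = Suc (length es)" using degree_monic_char_poly[OF Cons.prems(1)] by simp
    define m where "m = length es"
    note n = n[folded m_def]
    note A = Cons.prems(1)
    have "eigenvalue A e" unfolding eigenvalue_root_char_poly[OF A] Cons.prems(3) by simp
    then obtain v where "eigenvector A v e" by (auto simp: eigenvalue_def)
    then have v: "v \<in> carrier_vec n" "v \<noteq> 0\<^sub>v n" "A *\<^sub>v v = e \<cdot>\<^sub>v v"
      using A by (auto simp: eigenvector_def)
    obtain W c where W: "unitary n W" and col: "col W 0 = c \<cdot>\<^sub>v v"
      using unitary_completion[OF v(1,2)] n by auto
    note w = unitaryD[OF W]
    define B where "B = mat_adjoint W * A * W"
    have B: "B \<in> carrier_mat n n" using w A by (simp add: B_def)
    have BH: "mat_adjoint B = B"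
      using w A by (simp add: B_def mat_adjoint_mult[of _ n n _ n] mat_adjoint_adjoint Cons.prems(2) assoc_mult_mat[of _ n n _ n _ n])
    have col0: "col B 0 = e \<cdot>\<^sub>v unit_vec n 0"
    proof -
      have "col B 0 = mat_adjoint W *\<^sub>v (A *\<^sub>v col W 0)"
      proof -
        have "B = mat_adjoint W * (A * W)" unfolding B_def by (rule assoc_mult_mat[OF w(2) A w(1)])
        moreover have "0 < n" using n by simp
        ultimately show ?thesis
          by (simp only: col_mult2[OF w(2) mult_carrier_mat[OF A w(1)]] col_mult2[OF A w(1)])
      qed
      also have "A *\<^sub>v col W 0 = e \<cdot>\<^sub>v col W 0"
        using A v by (simp add: col mult_mat_vec[of _ n n] smult_smult_assoc mult.commute)
      also have "mat_adjoint W *\<^sub>v (e \<cdot>\<^sub>v col W 0) = e \<cdot>\<^sub>v col (mat_adjoint W * W) 0"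
      proof -
        have "col W 0 \<in> carrier_vec n" using w(1) n by (intro col_carrier_vec) auto
        moreover have "col (mat_adjoint W * W) 0 = mat_adjoint W *\<^sub>v col W 0"
          using n by (intro col_mult2[OF w(2,1)]) simp
        ultimately show ?thesis using mult_mat_vec[OF w(2)] by simp
      qed
      finally show ?thesis using w n by simp
    qed
    have Bc: "B $$ (i, 0) = (if i = 0 then e else 0)" if "i < n" for i
    proof -
      have "B $$ (i, 0) = col B 0 $ i" using B that by simp
      then show ?thesis using that n by (simp add: col0)
    qed
    \<comment> \<open>Hermiticity transfers the zeros of the first column to the first row, so
      \<open>B\<close> is block diagonal.\<close>
    have Br: "B $$ (0, i) = (if i = 0 then e else 0)" if "i < n" for i
    proof (cases "i = 0")
      case False
      have "B $$ (0, i) = cnj (B $$ (i, 0))"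
        using B that n by (subst BH[symmetric]) (auto simp: index_mat_adjoint)
      then show ?thesis using Bc[OF that] False by simp
    qed (use Bc that in auto)
    define C where "C = mat m m (\<lambda>(i, j). B $$ (Suc i, Suc j))"
    have C: "C \<in> carrier_mat m m" by (simp add: C_def)
    let ?E = "mat 1 1 (\<lambda>_. e) :: complex mat"
    have blk: "B = four_block_mat ?E (0\<^sub>m 1 m) (0\<^sub>m m 1) C"
      using B n Bc Br by (intro eq_matI) (auto simp: C_def)
    have CH: "mat_adjoint C = C"
    proof (rule eq_matI)
      fix i j assume "i < dim_row C" "j < dim_col C"
      then have "i < m" "j < m" by (auto simp: C_def)
      then have "mat_adjoint B $$ (Suc i, Suc j) = cnj (B $$ (Suc j, Suc i))" using B n by (intro index_mat_adjoint) auto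
      then show "mat_adjoint C $$ (i, j) = C $$ (i, j)"
        using \<open>i < m\<close> \<open>j < m\<close> unfolding BH by (simp add: index_mat_adjoint C_def)
    qed (simp_all add: C_def)
    have "similar_mat_wit B A (mat_adjoint W) W"
      using w A B by (intro similar_mat_witI[of _ _ n]) (auto simp: B_def)
    then have "char_poly A = char_poly B" by (metis char_poly_similar similar_mat_def)
    also have "\<dots> = char_poly ?E * char_poly C"
      unfolding blk by (rule char_poly_four_block_zeros_col[OF _ _ C]) auto
    also have "char_poly ?E = [:- e, 1:]"
      by (simp add: char_poly_defs det_def sign_def)
    \<comment> \<open>Cancelling the factor of \<open>e\<close> leaves the list \<open>es\<close>
      for \<open>C\<close>.\<close>
    finally have "char_poly C = (\<Prod>e\<leftarrow>es. [:- e, 1:])"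
      unfolding Cons.prems(3) by (simp del: mult_pCons_left)
    from Cons.IH[OF C CH this] obtain U
      where "unitary m U \<and> C = U * mat_diag m (\<lambda>i. es ! i) * mat_adjoint U" ..
    then have U: "unitary m U" and CU: "C = U * mat_diag m (\<lambda>i. es ! i) * mat_adjoint U"
      by blast+
    note u = unitaryD[OF U]
    \<comment> \<open>A 1 by 1 identity block extends \<open>U\<close> to a unitary matrix that
      diagonalizes \<open>B\<close>; then \<open>W * V\<close> diagonalizes
      \<open>A\<close>.\<close>
    define V where "V = four_block_mat (1\<^sub>m 1) (0\<^sub>m 1 m) (0\<^sub>m m 1) U"
    have V: "V \<in> carrier_mat n n" using u(1) n by (intro carrier_matI) (simp_all add: V_def)
    have Va: "mat_adjoint V = four_block_mat (1\<^sub>m 1) (0\<^sub>m 1 m) (0\<^sub>m m 1) (mat_adjoint U)"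
      using u(1) n by (intro eq_matI) (auto simp: V_def index_mat_adjoint)
    have D: "mat_diag n (\<lambda>i. (e # es) ! i) = four_block_mat ?E (0\<^sub>m 1 m) (0\<^sub>m m 1) (mat_diag m (\<lambda>i. es ! i))"
      using n by (intro eq_matI) (auto simp: mat_diag_def)
    have E: "?E \<in> carrier_mat 1 1" by simp
    note mult = mult_four_block_mat[of _ 1 1 _ m _ m _ _ 1 _ m]
    have one: "four_block_mat (1\<^sub>m 1) (0\<^sub>m 1 m) (0\<^sub>m m 1) (1\<^sub>m m) = (1\<^sub>m n :: complex mat)"
      using n by (intro eq_matI) auto
    have "mat_adjoint V * V = 1\<^sub>m n"
      unfolding Va unfolding V_def one[symmetric] using u by (subst mult) auto
    then have VU: "unitary n V" using V by (simp add: unitary_def)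
    have BV: "B = V * mat_diag n (\<lambda>i. (e # es) ! i) * mat_adjoint V"
    proof -
      let ?D = "mat_diag m (\<lambda>i. es ! i)"
      have UD: "U * ?D \<in> carrier_mat m m" by (rule mult_carrier_mat[OF u(1) mat_diag_dim])
      have "V * mat_diag n (\<lambda>i. (e # es) ! i) = four_block_mat ?E (0\<^sub>m 1 m) (0\<^sub>m m 1) (U * ?D)"
        unfolding D V_def using u(1) E UD
        by (subst mult) (simp_all add: left_mult_zero_mat[OF mat_diag_dim])
      also have "\<dots> * mat_adjoint V = four_block_mat ?E (0\<^sub>m 1 m) (0\<^sub>m m 1) (U * ?D * mat_adjoint U)"
        unfolding Va using u(2) E UD mult_carrier_mat[OF UD u(2)]
        by (subst mult) (simp_all add: left_mult_zero_mat[OF u(2)] right_mult_zero_mat[OF UD])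
      finally show ?thesis unfolding blk CU[symmetric] by (rule sym)
    qed
    have "A = W * B * mat_adjoint W"
    proof -
      have "W * B * mat_adjoint W = (W * mat_adjoint W) * A * (W * mat_adjoint W)"
        using w(1,2) A by (simp add: B_def assoc_mult_mat[of _ n n _ n _ n])
      then show ?thesis using w A by simp
    qed
    also have "\<dots> = (W * V) * mat_diag n (\<lambda>i. (e # es) ! i) * mat_adjoint (W * V)"
      unfolding BV using w(1,2) V mat_adjoint_carrier[OF V]
      by (simp add: mat_adjoint_mult[of _ n n _ n] assoc_mult_mat[of _ n n _ n _ n] mult_carrier_mat[of _ n n _ n])
    finally show ?case by (intro exI[of _ "W * V"] conjI unitary_mult[OF W VU])
  qed
  then obtain U where "unitary n U \<and> A = U * mat_diag n (\<lambda>i. es ! i) * mat_adjoint U" ..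
  then show ?thesis by (elim conjE) (rule that)
qed

section \<open>Eigenvalue lists of Hermitian matrices\<close>

lemma proots_linear_factors: "proots (\<Prod>e\<leftarrow>es. [:- e, 1:]) = mset (es :: complex list)"
proof (induction es)
  case (Cons e es)
  have "(\<Prod>e\<leftarrow>es. [:- e, 1:]) \<noteq> 0" by (auto simp: prod_list_zero_iff)
  then show ?case using Cons by (simp add: proots_mult del: mult_pCons_left)
qed simp

text \<open>The diagonal matrix of the eigenvalues is a unitary conjugate of \<open>A\<close>, hence
  Hermitian itself.\<close>

lemma hermitian_eigenvalues_real:
  assumes A: "A \<in> carrier_mat n n" "mat_adjoint A = A" and es: "char_poly A = (\<Prod>e\<leftarrow>es. [:- e, 1:])"
    and e: "e \<in> set es"
  shows "complex_of_real (Re e) = e"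
proof -
  obtain U where U: "unitary n U" and AU: "A = U * mat_diag n (\<lambda>i. es ! i) * mat_adjoint U"
    using hermitian_unitary_diagonalization[OF A es] by metis
  note u = unitaryD[OF U]
  let ?D = "mat_diag n (\<lambda>i. es ! i)"
  have D: "?D \<in> carrier_mat n n" by simp
  have "mat_adjoint U * A * U = (mat_adjoint U * U) * ?D * (mat_adjoint U * U)"
    unfolding AU using u(1,2) D by (simp add: assoc_mult_mat[of _ n n _ n _ n] mult_carrier_mat[of _ n n _ n])
  then have DU: "?D = mat_adjoint U * A * U" using u D by simp
  have "mat_adjoint ?D = ?D"
    unfolding DU using u(1,2) A by (simp add: mat_adjoint_mult[of _ n n _ n] mat_adjoint_adjoint assoc_mult_mat[of _ n n _ n _ n])
  then have "cnj (?D $$ (i, i)) = ?D $$ (i, i)" if "i < n" for i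
    using that D by (metis carrier_matD index_mat_adjoint)
  then have "cnj (es ! i) = es ! i" if "i < n" for i
    using that by (simp add: mat_diag_def)
  moreover have "length es = n"
    using degree_monic_char_poly[OF A(1)] degree_linear_factors[of uminus es] unfolding es by simp
  ultimately show ?thesis
    using e by (metis complex_eq_iff complex_of_real_def cnj.simps in_set_conv_nth Reals_cnj_iff of_real_Re)
qed

lemma eigenvalues_up_hermitian:
  assumes A: "A \<in> carrier_mat n n" "mat_adjoint A = A"
  shows "length (eigenvalues_up A) = n" "sorted (eigenvalues_up A)"
    "char_poly A = (\<Prod>e\<leftarrow>eigenvalues_up A. [:- complex_of_real e, 1:])"
proof -
  obtain es where es: "char_poly A = (\<Prod>e\<leftarrow>es. [:- e, 1:])" "length es = n"
    using char_poly_factorized[OF A(1)] by blast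
  have m: "mset (eigenvalues_up A) = image_mset Re (mset es)"
    by (simp add: eigenvalues_up_def es(1) proots_linear_factors)
  show "sorted (eigenvalues_up A)" by (simp add: eigenvalues_up_def)
  show "length (eigenvalues_up A) = n" using arg_cong[OF m, of size] es(2) by simp
  have "image_mset (\<lambda>e. complex_of_real (Re e)) (mset es) = image_mset (\<lambda>e. e) (mset es)"
    by (intro image_mset_cong) (auto intro: hermitian_eigenvalues_real[OF A es(1)])
  then have m': "image_mset complex_of_real (mset (eigenvalues_up A)) = mset es"
    unfolding m by (simp add: image_mset.compositionality o_def)
  have "char_poly A = prod_mset (image_mset (\<lambda>e. [:- e, 1:]) (mset es))"
    unfolding es(1) by (metis mset_map prod_mset_prod_list)
  also have "\<dots> = (\<Prod>e\<leftarrow>eigenvalues_up A. [:- complex_of_real e, 1:])"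
    unfolding m'[symmetric] by (simp add: image_mset.compositionality o_def prod_mset_prod_list[symmetric])
  finally show "char_poly A = (\<Prod>e\<leftarrow>eigenvalues_up A. [:- complex_of_real e, 1:])" .
qed

text \<open>Any ordering of the eigenvalues can serve as diagonal: the minimization takes the
  decreasing list for one matrix and the increasing list for the other.\<close>

lemma hermitian_spectral:
  assumes A: "A \<in> carrier_mat n n" "mat_adjoint A = A" and xs: "mset xs = mset (eigenvalues_up A)"
  obtains U where "unitary n U" "A = U * mat_diag n (\<lambda>i. complex_of_real (xs ! i)) * mat_adjoint U"
proof -
  have "char_poly A = prod_mset (image_mset (\<lambda>e. [:- complex_of_real e, 1:]) (mset (eigenvalues_up A)))"
    unfolding eigenvalues_up_hermitian(3)[OF A] by (metis mset_map prod_mset_prod_list)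
  also have "\<dots> = (\<Prod>e\<leftarrow>map complex_of_real xs. [:- e, 1:])"
    unfolding xs[symmetric] by (simp add: o_def prod_mset_prod_list[symmetric])
  finally obtain U where U: "unitary n U" "A = U * mat_diag n (\<lambda>i. map complex_of_real xs ! i) * mat_adjoint U"
    using hermitian_unitary_diagonalization[OF A] by metis
  have "length xs = n" using eigenvalues_up_hermitian(1)[OF A] xs by (metis size_mset)
  then have "mat_diag n (\<lambda>i. map complex_of_real xs ! i) = mat_diag n (\<lambda>i. complex_of_real (xs ! i))"
    by (intro eq_matI) (auto simp: mat_diag_def)
  with U show ?thesis using that by metis
qed

section \<open>Traces of powers determine the spectrum\<close>

lemma mat_trace_comm:
  assumes "A \<in> carrier_mat n m" "B \<in> carrier_mat m n"
  shows "mat_trace (A * B) = mat_trace (B * A)"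
proof -
  have "mat_trace (A * B) = (\<Sum>i<n. \<Sum>k<m. A $$ (i, k) * B $$ (k, i))"
    using assms index_mult_mat_sum[OF assms] by (simp add: mat_trace_def del: index_mult_mat(1))
  also have "\<dots> = (\<Sum>k<m. \<Sum>i<n. B $$ (k, i) * A $$ (i, k))"
    by (subst sum.swap) (simp add: mult.commute)
  also have "\<dots> = mat_trace (B * A)"
    using assms index_mult_mat_sum[OF assms(2,1)] by (simp add: mat_trace_def del: index_mult_mat(1))
  finally show ?thesis .
qed

lemma mat_trace_pow_similar:
  assumes "A \<in> carrier_mat n n" "similar_mat_wit A B P Q"
  shows "mat_trace (A ^\<^sub>m k) = mat_trace (B ^\<^sub>m k)"
proof -
  note D = similar_mat_witD2[OF assms]
  have Bk: "B ^\<^sub>m k \<in> carrier_mat n n" by (rule pow_carrier_mat[OF D(5)])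
  have "mat_trace (A ^\<^sub>m k) = mat_trace (P * (B ^\<^sub>m k * Q))"
    unfolding similar_mat_wit_pow_id[OF assms(2)] using D(5-7) Bk by (simp add: assoc_mult_mat[of _ n n _ n _ n])
  also have "\<dots> = mat_trace (B ^\<^sub>m k * Q * P)"
    using D Bk by (intro mat_trace_comm[of _ n n]) auto
  also have "B ^\<^sub>m k * Q * P = B ^\<^sub>m k"
    using D(2,6,7) Bk by (simp add: assoc_mult_mat[of _ n n _ n _ n] right_mult_one_mat[OF Bk])
  finally show ?thesis .
qed

lemma mat_diag_pow: "mat_diag n f ^\<^sub>m k = mat_diag n (\<lambda>i. f i ^ k)"
  by (induction k) (simp_all add: power_Suc2 del: power_Suc, simp add: mat_diag_def)

lemma mat_trace_pow_hermitian:
  assumes A: "A \<in> carrier_mat n n" "mat_adjoint A = A"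
  shows "mat_trace (A ^\<^sub>m k) = complex_of_real (\<Sum>e\<leftarrow>eigenvalues_up A. e ^ k)"
proof -
  let ?xs = "eigenvalues_up A"
  obtain U where U: "unitary n U" and AU: "A = U * mat_diag n (\<lambda>i. complex_of_real (?xs ! i)) * mat_adjoint U"
    using hermitian_spectral[OF A refl] .
  have "similar_mat_wit A (mat_diag n (\<lambda>i. complex_of_real (?xs ! i))) U (mat_adjoint U)"
    by (rule similar_mat_witI[OF unitaryD(4,3)[OF U] AU A(1) mat_diag_dim unitaryD(1,2)[OF U]])
  then have "mat_trace (A ^\<^sub>m k) = mat_trace (mat_diag n (\<lambda>i. complex_of_real (?xs ! i) ^ k))"
    unfolding mat_diag_pow[symmetric] by (rule mat_trace_pow_similar[OF A(1)])
  also have "\<dots> = (\<Sum>i<n. complex_of_real (?xs ! i ^ k))"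
    by (auto simp: mat_trace_def mat_diag_def)
  also have "\<dots> = complex_of_real (\<Sum>e\<leftarrow>?xs. e ^ k)"
    using eigenvalues_up_hermitian(1)[OF A] by (simp add: sum_list_sum_nth lessThan_atLeast0)
  finally show ?thesis .
qed

text \<open>Linear combinations of power sums are sums of polynomial values, and a polynomial that
  vanishes at every entry except \<open>z\<close> isolates the multiplicity of
  \<open>z\<close>.\<close>

lemma sorted_eq_if_power_sums_eq:
  fixes xs ys :: "real list"
  assumes "\<And>k. (\<Sum>x\<leftarrow>xs. x ^ k) = (\<Sum>y\<leftarrow>ys. y ^ k)" "sorted xs" "sorted ys"
  shows "xs = ys"
proof -
  have p: "(\<Sum>x\<leftarrow>xs. poly p x) = (\<Sum>y\<leftarrow>ys. poly p y)" for p
  proof -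
    have "(\<Sum>x\<leftarrow>zs. poly p x) = (\<Sum>i\<le>degree p. coeff p i * (\<Sum>x\<leftarrow>zs. x ^ i))" for zs
      by (induction zs) (simp_all add: poly_altdef sum.distrib algebra_simps)
    then show ?thesis using assms(1) by simp
  qed
  have "count (mset xs) z = count (mset ys) z" for z
  proof -
    define S where "S = (set xs \<union> set ys) - {z}"
    define p where "p = (\<Prod>w\<in>S. [:- w, 1:])"
    have fin: "finite S" by (simp add: S_def)
    have pz: "poly p z \<noteq> 0" using fin by (auto simp: p_def poly_prod S_def)
    have p0: "poly p w = 0" if "w \<in> S" for w
      using that fin by (auto simp: p_def poly_prod)
    have "(\<Sum>x\<leftarrow>zs. poly p x) = real (count (mset zs) z) * poly p z" if "set zs \<subseteq> set xs \<union> set ys" for zs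
      using that by (induction zs) (auto simp: algebra_simps S_def intro!: p0)
    then have "real (count (mset xs) z) * poly p z = real (count (mset ys) z) * poly p z"
      using p[of p] by (metis Un_upper1 Un_upper2)
    then show ?thesis using pz by simp
  qed
  then have "mset xs = mset ys" by (intro multiset_eqI)
  then show ?thesis using assms(2,3) by (metis properties_for_sort sorted_sort_id)
qed

lemma wigner_kernel_adjoint: "mat_adjoint (wigner_kernel N \<Omega>) = wigner_kernel N \<Omega>"
  using wigner_kernel_carrier[of N \<Omega>]
  by (intro eq_matI) (auto simp: index_mat_adjoint wigner_kernel_hermitian)

text \<open>Comparison through power sums: traces of powers pass to \<open>radial_mat\<close> by
  similarity, lose the azimuth there, and are constant in the polar angle. No rotation between the
  kernels has to be exhibited.\<close>

lemma eigenvalues_wigner_kernel_const: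
  "eigenvalues_up (wigner_kernel N \<Omega>) = eigenvalues_up (wigner_kernel N \<Omega>')"
proof -
  let ?E = "\<lambda>\<Omega>. eigenvalues_up (wigner_kernel N \<Omega>)"
  note H = wigner_kernel_carrier wigner_kernel_adjoint
  have "complex_of_real (\<Sum>e\<leftarrow>?E (\<theta>, \<phi>). e ^ k) = complex_of_real (\<Sum>i<N + 1. (radial_mat N \<theta> ^\<^sub>m k) $$ (i, i))" for \<theta> \<phi> k
  proof -
    let ?R = "map_mat complex_of_real (radial_mat N \<theta>)"
    obtain P Q where "similar_mat_wit (wigner_kernel N (\<theta>, \<phi>)) ?R P Q"
      using wigner_kernel_similar by blast
    then have "mat_trace (wigner_kernel N (\<theta>, \<phi>) ^\<^sub>m k) = mat_trace (?R ^\<^sub>m k)"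
      by (rule mat_trace_pow_similar[OF wigner_kernel_carrier])
    also have "?R ^\<^sub>m k = map_mat complex_of_real (radial_mat N \<theta> ^\<^sub>m k)"
      by (rule of_real_hom.mat_hom_pow[OF radial_mat_carrier, symmetric])
    also have "mat_trace \<dots> = complex_of_real (\<Sum>i<N + 1. (radial_mat N \<theta> ^\<^sub>m k) $$ (i, i))"
      using pow_carrier_mat[OF radial_mat_carrier[of N \<theta>], of k] unfolding mat_trace_def of_real_sum
      by (intro sum.cong) (auto simp: carrier_matD[OF radial_mat_carrier])
    finally show ?thesis unfolding mat_trace_pow_hermitian[OF H] .
  qed
  then have eq: "(\<Sum>e\<leftarrow>?E (\<theta>, \<phi>). e ^ k) = (\<Sum>i<N + 1. (radial_mat N \<theta> ^\<^sub>m k) $$ (i, i))" for \<theta> \<phi> k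
    by (simp only: of_real_eq_iff)
  have "(\<Sum>e\<leftarrow>?E \<Omega>. e ^ k) = (\<Sum>e\<leftarrow>?E \<Omega>'. e ^ k)" for k
    using trace_pow_radial_mat_const by (cases \<Omega>; cases \<Omega>') (simp only: eq)
  then show ?thesis
    by (rule sorted_eq_if_power_sums_eq) (rule eigenvalues_up_hermitian(2)[OF H])+
qed

subsection \<open>The minimal trace on a unitary orbit\<close>

lemma sum_mult_decreasing_nonneg:
  fixes l D :: "nat \<Rightarrow> real"
  assumes dec: "\<And>i j. i \<le> j \<Longrightarrow> j < n \<Longrightarrow> l j \<le> l i"
    and partial: "\<And>r. r < n \<Longrightarrow> 0 \<le> (\<Sum>i<r. D i)" and total: "(\<Sum>i<n. D i) = 0"
  shows "0 \<le> (\<Sum>i<n. l i * D i)"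
proof (cases n)
  case (Suc m)
  \<comment> \<open>Invariant form of Abel summation. Lowering \<open>l k\<close> to
    \<open>l (Suc k)\<close> is harmless since the partial sum is nonnegative; at
    \<open>k = n - 1\<close> the left side is 0 by \<open>total\<close>.\<close>
  have "k < n \<Longrightarrow> l k * (\<Sum>i<Suc k. D i) \<le> (\<Sum>i<Suc k. l i * D i)" for k
  proof (induction k)
    case (Suc k)
    have "l (Suc k) * (\<Sum>i<Suc k. D i) \<le> l k * (\<Sum>i<Suc k. D i)"
      using dec[of k "Suc k"] partial[of "Suc k"] Suc.prems by (intro mult_right_mono) auto
    also have "\<dots> \<le> (\<Sum>i<Suc k. l i * D i)" using Suc by simp
    finally have "l (Suc k) * (\<Sum>i<Suc k. D i) + l (Suc k) * D (Suc k) \<le> (\<Sum>i<Suc k. l i * D i) + l (Suc k) * D (Suc k)"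
      by simp
    then show ?case by (simp only: sum.lessThan_Suc[of _ "Suc k"] distrib_left)
  qed simp
  from this[of m] show ?thesis using Suc total by simp
qed simp

text \<open>Compared with the identity, the first \<open>r\<close> rows of \<open>P\<close> shift
  weight from the \<open>r\<close> smallest values of \<open>d\<close> to larger ones. So the
  changes have nonnegative partial sums, and Abel summation against the decreasing \<open>l\<close>
  concludes.\<close>

lemma doubly_stochastic_sum_ge:
  fixes P :: "nat \<Rightarrow> nat \<Rightarrow> real" and l d :: "nat \<Rightarrow> real"
  assumes nonneg: "\<And>i k. i < n \<Longrightarrow> k < n \<Longrightarrow> 0 \<le> P i k"
    and rows: "\<And>i. i < n \<Longrightarrow> (\<Sum>k<n. P i k) = 1" and cols: "\<And>k. k < n \<Longrightarrow> (\<Sum>i<n. P i k) = 1"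
    and dec: "\<And>i j. i \<le> j \<Longrightarrow> j < n \<Longrightarrow> l j \<le> l i" and inc: "\<And>i j. i \<le> j \<Longrightarrow> j < n \<Longrightarrow> d i \<le> d j"
  shows "(\<Sum>i<n. l i * d i) \<le> (\<Sum>i<n. l i * (\<Sum>k<n. P i k * d k))"
proof -
  define D where "D = (\<lambda>i. (\<Sum>k<n. P i k * d k) - d i)"
  define q where "q = (\<lambda>r k. (\<Sum>i<r. P i k) - (if k < r then 1 else 0))"
  have S: "(\<Sum>i<r. D i) = (\<Sum>k<n. q r k * d k)" if "r \<le> n" for r
  proof -
    have "(\<Sum>i<r. \<Sum>k<n. P i k * d k) = (\<Sum>k<n. (\<Sum>i<r. P i k) * d k)"
      by (subst sum.swap) (simp add: sum_distrib_right)
    moreover have "(\<Sum>i<r. d i) = (\<Sum>k<n. (if k < r then 1 else 0) * d k)"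
      using that by (intro sum.mono_neutral_cong_left) auto
    ultimately show ?thesis by (simp add: D_def q_def sum_subtractf left_diff_distrib)
  qed
  have q0: "(\<Sum>k<n. q r k) = 0" if "r \<le> n" for r
  proof -
    have "(\<Sum>k<n. \<Sum>i<r. P i k) = (\<Sum>i<r. \<Sum>k<n. P i k)" by (rule sum.swap)
    also have "\<dots> = (\<Sum>i<r. 1)" using that by (intro sum.cong rows) auto
    also have "\<dots> = (\<Sum>k<n. if k < r then 1 else 0)" using that by (intro sum.mono_neutral_cong_left) auto
    finally show ?thesis by (simp add: q_def sum_subtractf)
  qed
  have "0 \<le> (\<Sum>i<n. l i * D i)"
  proof (rule sum_mult_decreasing_nonneg[OF dec])
    fix r assume r: "r < n"
    \<comment> \<open>Since \<open>q r\<close> has total 0, \<open>d r\<close> may be subtracted.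
      Column sums make \<open>q r k\<close> nonpositive for \<open>k < r\<close> and nonnegative
      otherwise, which matches the sign of \<open>d k - d r\<close>.\<close>
    have "(\<Sum>i<r. D i) = (\<Sum>k<n. q r k * d k) - d r * (\<Sum>k<n. q r k)"
      using S q0 r by simp
    also have "\<dots> = (\<Sum>k<n. q r k * (d k - d r))"
      by (simp add: sum_distrib_left sum_subtractf[symmetric] algebra_simps)
    also have "0 \<le> \<dots>"
    proof (rule sum_nonneg)
      fix k assume "k \<in> {..<n}"
      then have k: "k < n" by simp
      have "0 \<le> (\<Sum>i<r. P i k)" using r k by (intro sum_nonneg nonneg) auto
      moreover have "(\<Sum>i<r. P i k) \<le> (\<Sum>i<n. P i k)" using r k by (intro sum_mono2 nonneg) auto
      ultimately show "0 \<le> q r k * (d k - d r)"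
        using cols[OF k] inc[of k r] inc[of r k] r k
        by (cases "k < r") (auto simp: q_def intro: mult_nonneg_nonneg mult_nonpos_nonpos)
    qed
    finally show "0 \<le> (\<Sum>i<r. D i)" .
  next
    have "(\<Sum>i<n. D i) = (\<Sum>k<n. q n k * d k)" by (rule S) simp
    also have "\<dots> = 0" by (intro sum.neutral) (simp add: q_def cols)
    finally show "(\<Sum>i<n. D i) = 0" .
  qed
  then show ?thesis by (simp add: D_def right_diff_distrib sum_subtractf)
qed

section \<open>The trace of a product in terms of both spectra\<close>

lemma mat_trace_diag_conj:
  assumes X: "X \<in> carrier_mat n n"
  shows "mat_trace (X * mat_diag n f * mat_adjoint X * mat_diag n g) =
    (\<Sum>i<n. f i * (\<Sum>k<n. complex_of_real ((cmod (X $$ (k, i)))\<^sup>2) * g k))"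
proof -
  have XD: "X * mat_diag n f = mat n n (\<lambda>(k, i). X $$ (k, i) * f i)" by (rule mat_diag_mult_right[OF X])
  have XDX: "X * mat_diag n f * mat_adjoint X \<in> carrier_mat n n"
    using X mat_adjoint_carrier[OF X] by (simp add: mult_carrier_mat[of _ n n _ n])
  have entry: "(X * mat_diag n f * mat_adjoint X) $$ (k, k) = (\<Sum>i<n. f i * complex_of_real ((cmod (X $$ (k, i)))\<^sup>2))" if "k < n" for k
    using that X unfolding index_mult_mat_sum[OF mult_carrier_mat[OF X mat_diag_dim] mat_adjoint_carrier[OF X] that that]
    by (intro sum.cong) (auto simp: XD index_mat_adjoint complex_norm_square simp del: of_real_power)
  have "mat_trace (X * mat_diag n f * mat_adjoint X * mat_diag n g) = (\<Sum>k<n. (X * mat_diag n f * mat_adjoint X) $$ (k, k) * g k)"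
    unfolding mat_diag_mult_right[OF XDX] mat_trace_def by simp
  also have "\<dots> = (\<Sum>k<n. \<Sum>i<n. f i * (complex_of_real ((cmod (X $$ (k, i)))\<^sup>2) * g k))"
    by (simp add: entry sum_distrib_right mult.assoc del: of_real_power)
  also have "\<dots> = (\<Sum>i<n. f i * (\<Sum>k<n. complex_of_real ((cmod (X $$ (k, i)))\<^sup>2) * g k))"
    by (subst sum.swap) (simp only: sum_distrib_left)
  finally show ?thesis .
qed

lemma unitary_col_norm:
  assumes X: "unitary n X" and i: "i < n"
  shows "(\<Sum>k<n. (cmod (X $$ (k, i)))\<^sup>2) = 1"
proof -
  note x = unitaryD[OF X]
  have "complex_of_real (\<Sum>k<n. (cmod (X $$ (k, i)))\<^sup>2) = (mat_adjoint X * X) $$ (i, i)"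
    unfolding index_mult_mat_sum[OF x(2,1) i i] of_real_sum
    using x(1) i by (intro sum.cong) (auto simp: index_mat_adjoint complex_norm_square mult.commute simp del: of_real_power)
  also have "\<dots> = 1" using i by (simp add: x(3))
  finally show ?thesis using of_real_eq_1_iff by blast
qed

lemma unitary_row_norm:
  assumes X: "unitary n X" and k: "k < n"
  shows "(\<Sum>i<n. (cmod (X $$ (k, i)))\<^sup>2) = 1"
  using unitary_col_norm[OF unitary_adjoint[OF X] k] unitaryD(1)[OF X] k
  by (simp add: index_mat_adjoint)

lemma trace_product_diagonalized:
  assumes U: "unitary n U" and V: "unitary n V"
    and A: "A = U * mat_diag n (\<lambda>i. complex_of_real (l i)) * mat_adjoint U"
    and B: "B = V * mat_diag n (\<lambda>i. complex_of_real (d i)) * mat_adjoint V"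
  shows "Re (mat_trace (A * B)) = (\<Sum>i<n. l i * (\<Sum>k<n. (cmod ((mat_adjoint V * U) $$ (k, i)))\<^sup>2 * d k))"
proof -
  let ?X = "mat_adjoint V * U" and ?L = "mat_diag n (\<lambda>i. complex_of_real (l i))" and ?D = "mat_diag n (\<lambda>i. complex_of_real (d i))"
  note u = unitaryD[OF U] and v = unitaryD[OF V]
  have c: "?L \<in> carrier_mat n n" "?D \<in> carrier_mat n n" by simp_all
  note assoc = assoc_mult_mat[of _ n n _ n _ n] mult_carrier_mat[of _ n n _ n]
  have "mat_trace (A * B) = mat_trace ((U * ?L * mat_adjoint U * V * ?D) * mat_adjoint V)"
    unfolding A B using u(1,2) v(1,2) c by (simp add: assoc)
  also have "\<dots> = mat_trace (mat_adjoint V * (U * ?L * mat_adjoint U * V * ?D))"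
    using u(1,2) v(1,2) c by (intro mat_trace_comm[of _ n n]) (auto simp: assoc)
  also have "mat_adjoint V * (U * ?L * mat_adjoint U * V * ?D) = ?X * ?L * mat_adjoint ?X * ?D"
    using u(1,2) v(1,2) c by (simp add: assoc mat_adjoint_mult[of _ n n _ n] mat_adjoint_adjoint)
  also have "mat_trace \<dots> = (\<Sum>i<n. complex_of_real (l i) * (\<Sum>k<n. complex_of_real ((cmod (?X $$ (k, i)))\<^sup>2) * complex_of_real (d k)))"
    using u(1) v(2) by (intro mat_trace_diag_conj) (auto simp: assoc)
  also have "\<dots> = complex_of_real (\<Sum>i<n. l i * (\<Sum>k<n. (cmod (?X $$ (k, i)))\<^sup>2 * d k))"
    by simp
  finally show ?thesis by (simp only: Re_complex_of_real)
qed

lemma mset_eigenvalues_down: "mset (eigenvalues_down A) = mset (eigenvalues_up A)"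
  by (simp add: eigenvalues_down_def)

lemma eigenvalues_down_decreasing:
  assumes "A \<in> carrier_mat n n" "mat_adjoint A = A" "i \<le> j" "j < n"
  shows "eigenvalues_down A ! j \<le> eigenvalues_down A ! i"
  using assms eigenvalues_up_hermitian(1,2)[OF assms(1,2)]
  by (auto simp: eigenvalues_down_def rev_nth intro!: sorted_nth_mono)

text \<open>Lower half of von Neumann's trace inequality: the squared moduli of the entries of a
  unitary matrix are doubly stochastic, and the two lists are ordered oppositely.\<close>

lemma trace_unitary_orbit_ge:
  assumes A: "A \<in> carrier_mat n n" "mat_adjoint A = A" and B: "B \<in> carrier_mat n n" "mat_adjoint B = B"
    and W: "unitary n W"
  shows "(\<Sum>i<n. eigenvalues_down A ! i * eigenvalues_up B ! i) \<le> Re (mat_trace (W * A * mat_adjoint W * B))"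
proof -
  define l d where ld: "l = (\<lambda>i. eigenvalues_down A ! i)" "d = (\<lambda>i. eigenvalues_up B ! i)"
  obtain U where U: "unitary n U" and AU: "A = U * mat_diag n (\<lambda>i. complex_of_real (l i)) * mat_adjoint U"
    unfolding ld using hermitian_spectral[OF A mset_eigenvalues_down] .
  obtain V where V: "unitary n V" and BV: "B = V * mat_diag n (\<lambda>i. complex_of_real (d i)) * mat_adjoint V"
    unfolding ld using hermitian_spectral[OF B refl] .
  note u = unitaryD[OF U] and w = unitaryD[OF W]
  have WA: "W * A * mat_adjoint W = (W * U) * mat_diag n (\<lambda>i. complex_of_real (l i)) * mat_adjoint (W * U)"
    unfolding AU using u(1,2) w(1,2) mat_diag_dim[of n "\<lambda>i. complex_of_real (l i)"]
    by (simp add: mat_adjoint_mult[of _ n n _ n] assoc_mult_mat[of _ n n _ n _ n] mult_carrier_mat[of _ n n _ n])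
  let ?X = "mat_adjoint V * (W * U)"
  have X: "unitary n ?X" by (intro unitary_mult unitary_adjoint U V W)
  have "(\<Sum>i<n. l i * d i) \<le> (\<Sum>i<n. l i * (\<Sum>k<n. (cmod (?X $$ (k, i)))\<^sup>2 * d k))"
    using eigenvalues_up_hermitian(1,2)[OF B]
    by (intro doubly_stochastic_sum_ge)
      (auto simp: ld unitary_col_norm[OF X] unitary_row_norm[OF X] intro: eigenvalues_down_decreasing[OF A] sorted_nth_mono)
  also have "\<dots> = Re (mat_trace (W * A * mat_adjoint W * B))"
    by (rule trace_product_diagonalized[OF unitary_mult[OF W U] V WA BV, symmetric])
  finally show ?thesis unfolding ld .
qed

text \<open>The witness \<open>V * mat_adjoint U\<close> carries an eigenbasis of \<open>A\<close>
  onto one of \<open>B\<close>, pairing large eigenvalues with small ones; the doubly stochastic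
  matrix becomes the identity.\<close>

lemma trace_unitary_orbit_attained:
  assumes A: "A \<in> carrier_mat n n" "mat_adjoint A = A" and B: "B \<in> carrier_mat n n" "mat_adjoint B = B"
  obtains W where "unitary n W"
    "Re (mat_trace (W * A * mat_adjoint W * B)) = (\<Sum>i<n. eigenvalues_down A ! i * eigenvalues_up B ! i)"
proof -
  define l d where ld: "l = (\<lambda>i. eigenvalues_down A ! i)" "d = (\<lambda>i. eigenvalues_up B ! i)"
  let ?L = "mat_diag n (\<lambda>i. complex_of_real (l i))"
  obtain U where U: "unitary n U" and AU: "A = U * ?L * mat_adjoint U"
    unfolding ld using hermitian_spectral[OF A mset_eigenvalues_down] .
  obtain V where V: "unitary n V" and BV: "B = V * mat_diag n (\<lambda>i. complex_of_real (d i)) * mat_adjoint V"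
    unfolding ld using hermitian_spectral[OF B refl] .
  note u = unitaryD[OF U] and v = unitaryD[OF V]
  let ?W = "V * mat_adjoint U"
  have "?W * A * mat_adjoint ?W = V * (mat_adjoint U * U) * ?L * (mat_adjoint U * U) * mat_adjoint V"
    unfolding AU using u(1,2) v(1,2) mat_diag_dim[of n "\<lambda>i. complex_of_real (l i)"]
    by (simp add: mat_adjoint_mult[of _ n n _ n] mat_adjoint_adjoint assoc_mult_mat[of _ n n _ n _ n] mult_carrier_mat[of _ n n _ n])
  also have "\<dots> = V * ?L * mat_adjoint V"
    using u(3) v(1,2) by (simp add: right_mult_one_mat[OF mult_carrier_mat[OF v(1) mat_diag_dim]])
  finally have "Re (mat_trace (?W * A * mat_adjoint ?W * B)) = (\<Sum>i<n. l i * (\<Sum>k<n. (cmod ((mat_adjoint V * V) $$ (k, i)))\<^sup>2 * d k))"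
    by (rule trace_product_diagonalized[OF V V _ BV])
  also have "\<dots> = (\<Sum>i<n. l i * d i)"
  proof (intro sum.cong refl)
    fix i assume "i \<in> {..<n}"
    then have "(\<Sum>k<n. (cmod ((mat_adjoint V * V) $$ (k, i)))\<^sup>2 * d k) = (\<Sum>k<n. if k = i then d i else 0)"
      unfolding v(3) by (intro sum.cong) auto
    with \<open>i \<in> {..<n}\<close> show "l i * (\<Sum>k<n. (cmod ((mat_adjoint V * V) $$ (k, i)))\<^sup>2 * d k) = l i * d i"
      by (simp add: sum.delta)
  qed
  finally show ?thesis
    using that unitary_mult[OF V unitary_adjoint[OF U]] unfolding ld by blast
qed

section \<open>From the unitary to the special unitary group\<close>

lemma det_mat_adjoint:
  assumes "A \<in> carrier_mat n n"
  shows "det (mat_adjoint A) = cnj (det A)"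
proof -
  interpret cnj: comm_ring_hom cnj by standard auto
  have "mat_adjoint A = transpose_mat (map_mat cnj A)"
    by (intro eq_matI) (auto simp: index_mat_adjoint)
  then show ?thesis
    using assms by (simp add: det_transpose[of _ n])
qed

lemma smult_smult_mat: "a \<cdot>\<^sub>m (b \<cdot>\<^sub>m A) = (a * b :: complex) \<cdot>\<^sub>m A"
  by (rule eq_matI) (auto simp: mult.assoc)

lemma one_smult_mat: "(1 :: complex) \<cdot>\<^sub>m A = A"
  by (rule eq_matI) auto

lemma mat_adjoint_smult: "mat_adjoint (c \<cdot>\<^sub>m A) = cnj c \<cdot>\<^sub>m mat_adjoint A"
  by (rule eq_matI) (auto simp: index_mat_adjoint)

lemma unitary_scale_to_SU:
  assumes W: "unitary n W" and n: "0 < n"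
  obtains c where "cmod c = 1" "c \<cdot>\<^sub>m W \<in> SU n"
proof -
  note w = unitaryD[OF W]
  have "cnj (det W) * det W = 1"
    using det_mult[OF w(2,1)] w(1,3) by (simp add: det_mat_adjoint)
  then have "complex_of_real ((cmod (det W))\<^sup>2) = 1"
    by (simp only: complex_norm_square mult.commute)
  then have "(cmod (det W))\<^sup>2 = 1" by (simp only: of_real_eq_1_iff)
  then have "cmod (det W) = 1" by (intro power2_eq_imp_eq[of _ 1]) simp_all
  then have dW: "det W = cis (Arg (det W))"
    using cis_Arg[of "det W"] by (cases "det W = 0") (auto simp: sgn_div_norm)
  \<comment> \<open>An \<open>n\<close>-th root of the inverse determinant, as scaling by
    \<open>c\<close> multiplies the determinant by \<open>c ^ n\<close>.\<close>
  define c where "c = cis (- Arg (det W) / real n)"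
  have "c ^ n = cis (- Arg (det W))"
    using n by (simp add: c_def Complex.DeMoivre)
  then have "c ^ n * det W = 1"
    by (subst dW) (simp add: cis_mult)
  then have "det (c \<cdot>\<^sub>m W) = 1" using w(1) by simp
  moreover
  have cc: "cnj c * c = 1"
    by (simp add: c_def cis_cnj cis_mult)
  have "mat_adjoint (c \<cdot>\<^sub>m W) * (c \<cdot>\<^sub>m W) = (cnj c * c) \<cdot>\<^sub>m (mat_adjoint W * W)"
    unfolding mat_adjoint_smult using w(1,2)
    by (simp only: mult_smult_assoc_mat[OF w(2) smult_carrier_mat[OF w(1)]] mult_smult_distrib[OF w(2,1)] smult_smult_mat)
  then have "mat_adjoint (c \<cdot>\<^sub>m W) * (c \<cdot>\<^sub>m W) = 1\<^sub>m n"
    by (simp add: cc w(3) one_smult_mat)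
  ultimately have "c \<cdot>\<^sub>m W \<in> SU n" using w(1) by (simp add: SU_def)
  moreover have "cmod c = 1" by (simp add: c_def)
  ultimately show ?thesis using that by blast
qed

lemma conj_smult_unit:
  assumes A: "A \<in> carrier_mat n n" and W: "W \<in> carrier_mat n n" and c: "cmod c = 1"
  shows "(c \<cdot>\<^sub>m W) * A * mat_adjoint (c \<cdot>\<^sub>m W) = W * A * mat_adjoint W"
proof -
  have "c * cnj c = 1" using c by (simp add: complex_norm_square[symmetric])
  then show ?thesis
    unfolding mat_adjoint_smult mult_smult_assoc_mat[OF W A]
      mult_smult_assoc_mat[OF mult_carrier_mat[OF W A] smult_carrier_mat[OF mat_adjoint_carrier[OF W]]]
      mult_smult_distrib[OF mult_carrier_mat[OF W A] mat_adjoint_carrier[OF W]]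
    by (simp only: smult_smult_mat one_smult_mat)
qed

text \<open>The spectrum of the kernel is the same everywhere, so any point
  \<open>\<Omega>\<^sub>0\<close> can name it. The sum is then the minimum of the Wigner function
  over the unitary orbit, at every point of the sphere.\<close>

theorem proposition1:
  fixes N :: nat and \<Omega>\<^sub>0 :: "real \<times> real" and W_min :: real and \<rho> :: "complex mat"
  assumes "N \<ge> 1"
    and "\<Omega>\<^sub>0 \<in> S2"
    and "W_min \<in> {eigenvalues_up (wigner_kernel N \<Omega>\<^sub>0) ! 0 .. 1 / (real N + 1)}"
    and "spin_state N \<rho>"
  shows "(\<forall>\<Omega> \<in> S2. \<forall>U \<in> SU (N + 1). wigner_function N (U * \<rho> * mat_adjoint U) \<Omega> \<ge> W_min)
    \<longleftrightarrow> (\<Sum>i = 0..N. eigenvalues_down \<rho> ! i * eigenvalues_up (wigner_kernel N \<Omega>\<^sub>0) ! i) \<ge> W_min"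
proof -
  let ?n = "N + 1" and ?K = "wigner_kernel N"
  have \<rho>: "\<rho> \<in> carrier_mat ?n ?n" "mat_adjoint \<rho> = \<rho>"
    using assms(4) by (auto simp: spin_state_def psd_def)
  note K = wigner_kernel_carrier[of N] wigner_kernel_adjoint[of N]
  have range: "{0..N} = {..<?n}" by auto
  show ?thesis unfolding range
  proof
    assume all: "\<forall>\<Omega> \<in> S2. \<forall>U \<in> SU ?n. wigner_function N (U * \<rho> * mat_adjoint U) \<Omega> \<ge> W_min"
    \<comment> \<open>The assumption is evaluated at the minimizer for
      \<open>\<Omega>\<^sub>0\<close>, whose determinant is corrected by a phase that conjugation
      does not see.\<close>
    obtain W where W: "unitary ?n W"
      and eq: "Re (mat_trace (W * \<rho> * mat_adjoint W * ?K \<Omega>\<^sub>0)) = (\<Sum>i<?n. eigenvalues_down \<rho> ! i * eigenvalues_up (?K \<Omega>\<^sub>0) ! i)"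
      using trace_unitary_orbit_attained[OF \<rho> K] .
    obtain c where c: "cmod c = 1" "c \<cdot>\<^sub>m W \<in> SU ?n"
      using unitary_scale_to_SU[OF W] by auto
    from all assms(2) c(2) have "W_min \<le> wigner_function N ((c \<cdot>\<^sub>m W) * \<rho> * mat_adjoint (c \<cdot>\<^sub>m W)) \<Omega>\<^sub>0" by blast
    then show "W_min \<le> (\<Sum>i<?n. eigenvalues_down \<rho> ! i * eigenvalues_up (?K \<Omega>\<^sub>0) ! i)"
      unfolding conj_smult_unit[OF \<rho>(1) unitaryD(1)[OF W] c(1)] wigner_function_def eq .
  next
    assume le: "W_min \<le> (\<Sum>i<?n. eigenvalues_down \<rho> ! i * eigenvalues_up (?K \<Omega>\<^sub>0) ! i)"
    show "\<forall>\<Omega> \<in> S2. \<forall>U \<in> SU ?n. wigner_function N (U * \<rho> * mat_adjoint U) \<Omega> \<ge> W_min"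
    proof (intro ballI)
      fix \<Omega> U assume "U \<in> SU ?n"
      then have "unitary ?n U" by (simp add: SU_def unitary_def)
      \<comment> \<open>The orbit bound comes with the eigenvalues at \<open>\<Omega>\<close>, which
        are those at \<open>\<Omega>\<^sub>0\<close>.\<close>
      from trace_unitary_orbit_ge[OF \<rho> K this, of \<Omega>] le
      show "wigner_function N (U * \<rho> * mat_adjoint U) \<Omega> \<ge> W_min"
        unfolding wigner_function_def eigenvalues_wigner_kernel_const[of N \<Omega> \<Omega>\<^sub>0] by linarith
    qed
  qed
qed

end
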